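(* Let $q$ be a prime power, let $\ell, N$ be positive integers, and let $n = \ell N$ be a sum-rank length partition with equal sublengths $N = n_1 = \cdots = n_\ell$ (extension degree $m=1$). Let $r \geq N$ and let $s \geq 0$ be the remainder of $r$ divided by $N$. If $\mathcal{C} \subseteq \mathbb{F}_q^n$ is a proper sum-rank simplex code of dimension $r$, then $$ \mathrm{d}_{SR}(\mathcal{C}) \geq \begin{cases} \left\lceil \dfrac{q^{r-1}(q-1)}{q^N-1} \right\rceil & \text{if } s = 0, \\[1em] \left\lfloor \dfrac{q^{r-1}(q-1)}{q^N-1} \right\rfloor - q^s + 1 & \text{if } s > 0. \end{cases} $$
   Context: Sum-rank metric for $m=1$: for $\mathbf{c} = (\mathbf{c}^{(1)}, \ldots, \mathbf{c}^{(\ell)}) \in \mathbb{F}_q^n$ with $\mathbf{c}^{(i)} \in \mathbb{F}_q^{N}$, the sum-rank weight is $\mathrm{wt}_{SR}(\mathbf{c}) = \sum_{i=1}^\ell \mathrm{Rk}(\mathbf{c}^{(i)})$, where $\mathbf{c}^{(i)}$ is viewed as a $1\times N$ matrix over $\mathbb{F}_q$ (so the weight is the number of nonzero blocks). For a linear code (subspace) $\mathcal{C}$, $\mathrm{d}_{SR}(\mathcal{C}) = \min\{\mathrm{wt}_{SR}(\mathbf{c}) \mid \mathbf{c} \in \mathcal{C}\setminus\{\mathbf{0}\}\}$. Proper sum-rank Hamming code ($m=1$): a linear code $\mathcal{C} \subseteq \mathbb{F}_q^n$, $n = \ell N$, of redundancy $r = n - \dim(\mathcal{C})$, such that $\mathrm{d}_{SR}(\mathcal{C})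 \geq 3$ and there is no linear code $\mathcal{C}' \subseteq \mathbb{F}_q^{n'}$ with $\mathrm{d}_{SR}(\mathcal{C}') \geq 3$ and $n' - \dim(\mathcal{C}') = r$ for a partition $n' = \ell' N$ into $\ell'$ blocks of the same length $N$ with $\ell' > \ell$. A linear code $\mathcal{C}\subseteq\mathbb{F}_q^n$ is a proper sum-rank simplex code if its dual $\mathcal{C}^\perp$ (with respect to the standard inner product of $\mathbb{F}_q^n$) is a proper sum-rank Hamming code. *)

theory Defs
  imports "Jordan_Normal_Form.DL_Rank" "HOL-Library.Cardinality" "HOL-Library.Extended_Real"
begin

definition linear_code :: "nat \<Rightarrow> 'a::field vec set \<Rightarrow> bool" where
  "linear_code n C \<longleftrightarrow> VectorSpace.subspace class_ring C (module_vec TYPE('a) n)"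

definition code_dim :: "nat \<Rightarrow> 'a::field vec set \<Rightarrow> nat" where
  "code_dim n C = vectorspace.dim class_ring ((module_vec TYPE('a) n)\<lparr>carrier := C\<rparr>)"

text \<open>For a linear code the dimension is at most \<open>n\<close>, so the subtraction does not truncate.\<close>

definition redundancy :: "nat \<Rightarrow> 'a::field vec set \<Rightarrow> nat" where
  "redundancy n C = n - code_dim n C"

definition dual_code :: "nat \<Rightarrow> 'a::field vec set \<Rightarrow> 'a vec set" where
  "dual_code n C = vec_module.orthogonal_complement n C"

text \<open>Blocks are numbered from \<open>0\<close>; block \<open>i\<close> is read as a matrix with one row
  (extension degree 1).\<close>

definition block :: "nat \<Rightarrow> 'a::field vec \<Rightarrow> nat \<Rightarrow> 'a mat" where
  "block N c i = mat 1 N (\<lambda>(_, j). c $ (i * N + j))"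

definition wt_SR :: "nat \<Rightarrow> nat \<Rightarrow> 'a::field vec \<Rightarrow> nat" where
  "wt_SR l N c = (\<Sum>i<l. vec_space.rank 1 (block N c i))"

text \<open>For a nonzero code the infimum is an attained minimum. The zero code has no nonzero
  codeword; its distance is \<open>\<infinity>\<close>, so that it counts as a code of distance at least 3.\<close>

definition d_SR :: "nat \<Rightarrow> nat \<Rightarrow> 'a::field vec set \<Rightarrow> enat" where
  "d_SR l N C = (INF c \<in> C - {0\<^sub>v (l * N)}. enat (wt_SR l N c))"

text \<open>Codes of length \<open>l * N\<close>, split into \<open>l\<close> blocks of length \<open>N\<close>. The competing codes
  are over the same field.\<close>

definition proper_SR_Hamming_code :: "nat \<Rightarrow> nat \<Rightarrow> 'a::field vec set \<Rightarrow> bool" where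
  "proper_SR_Hamming_code l N C \<longleftrightarrow>
     linear_code (l * N) C \<and> d_SR l N C \<ge> 3 \<and>
     \<not> (\<exists>l' (C' :: 'a vec set). l' > l \<and> linear_code (l' * N) C' \<and> d_SR l' N C' \<ge> 3 \<and>
           redundancy (l' * N) C' = redundancy (l * N) C)"

definition proper_SR_simplex_code :: "nat \<Rightarrow> nat \<Rightarrow> 'a::field vec set \<Rightarrow> bool" where
  "proper_SR_simplex_code l N C \<longleftrightarrow>
     linear_code (l * N) C \<and> proper_SR_Hamming_code l N (dual_code (l * N) C)"

end

theory Submission
  imports Defs "HOL-Algebra.Algebraic_Closure_Type"
begin

text \<open>
  Let \<open>D\<close> be the dual of \<open>C\<close>. Since \<open>D\<close> has distance at least 3, the vectors supported on a
  single block lie in pairwise distinct cosets of \<open>D\<close>, so modulo \<open>D\<close> the blocks form a partial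
  spread of \<open>N\<close>-dimensional subspaces in a space of dimension \<open>r\<close>. A nonzero codeword
  \<open>c \<in> C\<close> with \<open>w\<close> nonzero blocks defines a hyperplane containing \<open>l - w\<close> members of
  this spread, whence \<open>1 + (l - w) (q ^ N - 1) \<le> q ^ (r - 1)\<close>. As the Hamming code has
  maximal length, \<open>l\<close> is at least the size \<open>(q ^ r - q ^ (N + s)) / (q ^ N - 1) + 1\<close> of
  the partial spread obtained by repeatedly lifting the multiplications of a finite field. The two
  inequalities give the bound on \<open>w\<close>. Dimensions are handled by counting: a code of dimension
  \<open>k\<close> has \<open>q ^ k\<close> elements.
\<close>

no_notation fps_nth (infixl \<open>$\<close> 75)

section \<open>Counting in linear codes\<close>

lemma card_carrier_vec: "card (carrier_vec n :: 'a::finite vec set) = CARD('a) ^ n"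
proof -
  have "bij_betw vec_of_list {xs :: 'a list. set xs \<subseteq> UNIV \<and> length xs = n} (carrier_vec n)"
    by (rule bij_betw_byWitness[where f' = list_of_vec])
      (auto simp: list_vec vec_list intro!: carrier_vecI)
  then show ?thesis
    using card_lists_length_eq[of "UNIV :: 'a set" n] by (simp add: bij_betw_same_card)
qed

lemma finite_carrier_vec: "finite (carrier_vec n :: 'a::finite vec set)"
  by (rule card_ge_0_finite) (simp add: card_carrier_vec)

text \<open>Multiplication by a nonzero \<open>x\<close> permutes the nonzero elements. Their
  product is thus unchanged while it picks up the factor \<open>x ^ (q - 1)\<close>, which must be
  1.\<close>

lemma finite_field_pow_card:
  fixes x :: "'a::{field, finite}"
  shows "x ^ CARD('a) = x"
proof (cases "x = 0")
  case False
  let ?U = "UNIV - {0 :: 'a}"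
  have "\<Prod>?U = (\<Prod>y\<in>?U. x * y)"
    by (rule sym, rule prod.reindex_bij_witness[of _ "\<lambda>y. y / x" "\<lambda>y. x * y"]) (use False in auto)
  also have "\<dots> = x ^ card ?U * \<Prod>?U"
    by (simp add: prod.distrib)
  finally have "x ^ card ?U = 1"
    by simp
  then show ?thesis
    using power_minus_mult[of "CARD('a)" x] by (simp add: card_Diff_singleton)
qed (simp add: finite_UNIV_card_ge_0)

lemma two_le_card_field: "2 \<le> CARD('a::{field, finite})"
  using card_mono[of UNIV "{0, 1 :: 'a}"] by simp

text \<open>Subtracting \<open>w\<close> carries the fibre over \<open>h w\<close> bijectively onto
  the fibre over \<open>z\<close>, so all nonempty fibres have one size. Additivity of
  \<open>h\<close> enters only through differences, which covers both scalar products and matrix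
  maps.\<close>

lemma card_fibres:
  fixes h :: "'a::ring vec \<Rightarrow> 'b"
  assumes W: "finite W" "W \<subseteq> carrier_vec n"
    and add: "\<And>x y. x \<in> W \<Longrightarrow> y \<in> W \<Longrightarrow> x + y \<in> W"
    and minus: "\<And>x y. x \<in> W \<Longrightarrow> y \<in> W \<Longrightarrow> x - y \<in> W"
    and h: "\<And>x y. x \<in> W \<Longrightarrow> y \<in> W \<Longrightarrow> h x = h y \<longleftrightarrow> h (x - y) = z"
  shows "card W = card (h ` W) * card {x \<in> W. h x = z}"
proof -
  have fibre: "card {x \<in> W. h x = y} = card {x \<in> W. h x = z}" if "y \<in> h ` W" for y
  proof -
    from that obtain w where w: "w \<in> W" "y = h w" by auto
    have plus_minus: "x + w - w = x" "x - w + w = x" if "x \<in> W" for x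
    proof -
      have "x \<in> carrier_vec n" "w \<in> carrier_vec n"
        using that w W(2) by auto
      then show "x + w - w = x" "x - w + w = x"
        by auto
    qed
    have "bij_betw (\<lambda>x. x - w) {x \<in> W. h x = y} {x \<in> W. h x = z}"
      by (rule bij_betw_byWitness[where f' = "\<lambda>x. x + w"])
        (use w h minus add plus_minus in auto)
    then show ?thesis by (rule bij_betw_same_card)
  qed
  have "card W = (\<Sum>y\<in>h ` W. card {x \<in> W. h x = y})"
    using sum.image_gen[OF W(1), of "\<lambda>_. 1 :: nat" h] by simp
  then show ?thesis
    by (simp add: fibre)
qed

lemma linear_codeD:
  fixes C :: "'a::field vec set"
  assumes "linear_code n C"
  shows linear_code_subset: "C \<subseteq> carrier_vec n"
    and linear_code_zero: "0\<^sub>v n \<in> C"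
    and linear_code_add: "\<And>x y. x \<in> C \<Longrightarrow> y \<in> C \<Longrightarrow> x + y \<in> C"
    and linear_code_smult: "\<And>a x. x \<in> C \<Longrightarrow> a \<cdot>\<^sub>v x \<in> C"
    and linear_code_minus: "\<And>x y. x \<in> C \<Longrightarrow> y \<in> C \<Longrightarrow> x - y \<in> C"
proof -
  interpret submodule class_ring C "module_vec TYPE('a) n"
    using assms by (simp add: linear_code_def VectorSpace.subspace_def)
  show sub: "C \<subseteq> carrier_vec n" "0\<^sub>v n \<in> C"
    using subset zero_closed by (simp_all add: module_vec_def)
  show add: "x + y \<in> C" if "x \<in> C" "y \<in> C" for x y
    using m_closed[OF that] by (simp add: module_vec_def)
  show smult: "a \<cdot>\<^sub>v x \<in> C" if "x \<in> C" for a x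
    using smult_closed[OF _ that, of a] by (simp add: module_vec_def)
  show "x - y \<in> C" if "x \<in> C" "y \<in> C" for x y
  proof -
    have "x - y = x + (- 1) \<cdot>\<^sub>v y"
    proof -
      have "x \<in> carrier_vec n" "y \<in> carrier_vec n"
        using that sub by auto
      then show ?thesis by auto
    qed
    then show ?thesis using add smult that by simp
  qed
qed

lemma linear_codeI:
  fixes C :: "'a::field vec set"
  assumes "C \<subseteq> carrier_vec n" "0\<^sub>v n \<in> C"
    and "\<And>x y. x \<in> C \<Longrightarrow> y \<in> C \<Longrightarrow> x + y \<in> C"
    and "\<And>a x. x \<in> C \<Longrightarrow> a \<cdot>\<^sub>v x \<in> C"
  shows "linear_code n C"
  unfolding linear_code_def VectorSpace.subspace_def
  using assms vec_vs[where 'a = 'a] vec_module[where 'a = 'a]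
  by (auto intro!: submodule.intro simp: module_vec_def)

text \<open>Coordinates in a basis put the codewords in bijection with the coefficient families.
  This is the bridge from the dimension to counting arguments.\<close>

lemma card_linear_code:
  fixes C :: "'a::{field, finite} vec set"
  assumes "linear_code n C"
  shows "card C = CARD('a) ^ code_dim n C"
proof -
  let ?V = "(module_vec TYPE('a) n)\<lparr>carrier := C\<rparr>"
  have "vectorspace class_ring ?V"
    by (rule vectorspace.subspace_is_vs[OF vec_vs]) (use assms in \<open>simp add: linear_code_def\<close>)
  then interpret W: vectorspace class_ring ?V .
  have fin: "finite C"
    using finite_subset[OF linear_code_subset[OF assms] finite_carrier_vec] .
  \<comment> \<open>A finite code is a finite generating set of itself.\<close>
  have "W.fin_dim"
    unfolding W.fin_dim_def
    by (rule exI[of _ C]) (use fin W.in_own_span[of C] W.span_is_subset2[of C] in \<open>simp add: subset_antisym\<close>)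
  then obtain B where B: "finite B" "W.basis B"
    using W.finite_basis_exists by blast
  then have sub: "B \<subseteq> carrier ?V"
    by (simp add: W.basis_def)
  have carr: "carrier ?V = C" "carrier (class_ring :: 'a ring) = UNIV"
    by simp_all
  note criterion = W.basis_criterion[OF B(1) sub, THEN iffD1, OF B(2), unfolded carr]
  have uniq: "\<exists>!a. a \<in> B \<rightarrow>\<^sub>E (UNIV :: 'a set) \<and> W.lincomb a B = v" if "v \<in> C" for v
    by (rule criterion[rule_format, OF that])
  have closed: "W.lincomb a B \<in> C" for a
    by (rule W.lincomb_closed[OF sub, of a, unfolded carr]) simp
  have "bij_betw (\<lambda>a. W.lincomb a B) (B \<rightarrow>\<^sub>E (UNIV :: 'a set)) C"
    unfolding bij_betw_def inj_on_def
  proof (intro conjI ballI impI equalityI subsetI)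
    fix a b assume "a \<in> B \<rightarrow>\<^sub>E (UNIV :: 'a set)" "b \<in> B \<rightarrow>\<^sub>E UNIV"
      and "W.lincomb a B = W.lincomb b B"
    then show "a = b" using uniq[OF closed] by blast
  next
    fix v assume "v \<in> C"
    then show "v \<in> (\<lambda>a. W.lincomb a B) ` (B \<rightarrow>\<^sub>E (UNIV :: 'a set))"
      using uniq by blast
  next
    fix v assume "v \<in> (\<lambda>a. W.lincomb a B) ` (B \<rightarrow>\<^sub>E (UNIV :: 'a set))"
    then show "v \<in> C" using closed by blast
  qed
  then have "card C = CARD('a) ^ card B"
    using bij_betw_same_card by (fastforce simp: card_PiE[OF B(1)])
  then show ?thesis
    by (simp add: code_dim_def W.dim_basis[OF B])
qed

section \<open>Dual codes and their cardinality\<close>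

lemma mem_dual_code:
  "x \<in> dual_code n C \<longleftrightarrow> x \<in> carrier_vec n \<and> (\<forall>y\<in>C. x \<bullet> y = 0)"
  by (simp add: dual_code_def vec_module.orthogonal_complement_def)

lemma linear_code_carrier_vec: "linear_code n (carrier_vec n :: 'a::field vec set)"
  by (rule linear_codeI) auto

lemma linear_code_dual_code:
  assumes "C \<subseteq> carrier_vec n"
  shows "linear_code n (dual_code n (C :: 'a::field vec set))"
proof (rule linear_codeI)
  show "0\<^sub>v n \<in> dual_code n C"
    using assms by (auto simp: mem_dual_code)
  show "x + y \<in> dual_code n C" if "x \<in> dual_code n C" "y \<in> dual_code n C" for x y
    unfolding mem_dual_code
  proof (intro conjI ballI)
    show "x + y \<in> carrier_vec n"
      using that by (simp add: mem_dual_code)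
    fix c assume "c \<in> C"
    then show "(x + y) \<bullet> c = 0"
      using that assms add_scalar_prod_distrib[of x n y c] by (auto simp: mem_dual_code)
  qed
  show "a \<cdot>\<^sub>v x \<in> dual_code n C" if "x \<in> dual_code n C" for a x
    unfolding mem_dual_code
  proof (intro conjI ballI)
    show "a \<cdot>\<^sub>v x \<in> carrier_vec n"
      using that by (simp add: mem_dual_code)
    fix c assume "c \<in> C"
    then show "(a \<cdot>\<^sub>v x) \<bullet> c = 0"
      using that assms smult_scalar_prod_distrib[of x n c a] by (auto simp: mem_dual_code)
  qed
qed (auto simp: mem_dual_code)

text \<open>A functional that is nonzero somewhere on \<open>W\<close> takes every value of the
  field, by scaling, and its q fibres have equal size.\<close>

lemma card_kernel_functional:
  fixes W :: "'a::{field, finite} vec set"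
  assumes W: "linear_code n W" and x: "x \<in> carrier_vec n"
    and ex: "\<exists>w\<in>W. w \<bullet> x \<noteq> 0"
  shows "card W = CARD('a) * card {w \<in> W. w \<bullet> x = 0}"
proof -
  note sub = linear_code_subset[OF W]
  obtain w where w: "w \<in> W" "w \<bullet> x \<noteq> 0"
    using ex by blast
  have "t \<in> (\<lambda>w. w \<bullet> x) ` W" for t
  proof
    show "(t / (w \<bullet> x)) \<cdot>\<^sub>v w \<in> W"
      by (rule linear_code_smult[OF W w(1)])
    show "t = ((t / (w \<bullet> x)) \<cdot>\<^sub>v w) \<bullet> x"
      using smult_scalar_prod_distrib[of w n x "t / (w \<bullet> x)"] w sub x by auto
  qed
  then have im: "(\<lambda>w. w \<bullet> x) ` W = UNIV"
    by blast
  have "card W = card ((\<lambda>w. w \<bullet> x) ` W) * card {w \<in> W. w \<bullet> x = 0}"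
  proof (rule card_fibres)
    show "finite W"
      using finite_subset[OF sub finite_carrier_vec] .
    show "W \<subseteq> carrier_vec n" by (rule sub)
    fix u v assume uv: "u \<in> W" "v \<in> W"
    show "u + v \<in> W" "u - v \<in> W"
      using uv linear_code_add[OF W] linear_code_minus[OF W] by auto
    have "(u - v) \<bullet> x = u \<bullet> x - v \<bullet> x"
      using uv sub x by (intro minus_scalar_prod_distrib) auto
    then show "u \<bullet> x = v \<bullet> x \<longleftrightarrow> (u - v) \<bullet> x = 0"
      by simp
  qed
  then show ?thesis
    by (simp add: im)
qed

lemma card_hyperplane:
  fixes c :: "'a::{field, finite} vec"
  assumes c: "c \<in> carrier_vec n" "c \<noteq> 0\<^sub>v n"
  shows "CARD('a) * card {v \<in> carrier_vec n. v \<bullet> c = 0} = CARD('a) ^ n"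
proof -
  obtain i where "i < n" "c $ i \<noteq> 0"
    using c by (metis eq_vecI carrier_vecD index_zero_vec)
  then have "\<exists>w\<in>carrier_vec n. w \<bullet> c \<noteq> 0"
    using c by (intro bexI[of _ "unit_vec n i"]) auto
  then show ?thesis
    using card_kernel_functional[OF linear_code_carrier_vec c(1)] by (simp add: card_carrier_vec)
qed

text \<open>Orthogonal pairs of a codeword and a vector are counted twice. The zero codeword is
  orthogonal to all vectors, any other to one in q. A vector of the dual is orthogonal to all of
  \<open>C\<close>, any other to one codeword in q.\<close>

lemma card_mult_card_dual_code:
  fixes C :: "'a::{field, finite} vec set"
  assumes C: "linear_code n C"
  shows "card C * card (dual_code n C) = CARD('a) ^ n"
proof -
  let ?q = "CARD('a)" and ?V = "carrier_vec n :: 'a vec set" and ?D = "dual_code n C"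
  define S where "S = (\<Sum>c\<in>C. card {v \<in> ?V. v \<bullet> c = 0})"
  note sub = linear_code_subset[OF C]
  have fin: "finite C" "finite ?V" "finite ?D"
    using finite_subset[OF sub finite_carrier_vec]
      finite_subset[OF linear_code_subset[OF linear_code_dual_code[OF sub]] finite_carrier_vec]
    by (auto simp: finite_carrier_vec)
  \<comment> \<open>The factor q turns the fractions 1/q of both counts into integers.\<close>
  have "?q * S = (\<Sum>c\<in>C. if c = 0\<^sub>v n then ?q * ?q ^ n else ?q ^ n)"
    unfolding S_def sum_distrib_left
  proof (rule sum.cong[OF refl])
    fix c assume "c \<in> C"
    then have c: "c \<in> carrier_vec n" using sub by auto
    have "{v \<in> ?V. v \<bullet> 0\<^sub>v n = 0} = ?V"
      by auto
    then show "?q * card {v \<in> ?V. v \<bullet> c = 0} = (if c = 0\<^sub>v n then ?q * ?q ^ n else ?q ^ n)"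
      using card_hyperplane[OF c] by (simp add: card_carrier_vec)
  qed
  also have "\<dots> = ?q * ?q ^ n + (\<Sum>c\<in>C - {0\<^sub>v n}. ?q ^ n)"
    by (subst sum.remove[OF fin(1) linear_code_zero[OF C]]) (auto intro!: sum.cong)
  also have "\<dots> = ?q * ?q ^ n + (card C - 1) * ?q ^ n"
    using fin linear_code_zero[OF C] by simp
  finally have "?q * S + ?q ^ n = ?q * ?q ^ n + (card C - 1 + 1) * ?q ^ n"
    by simp
  moreover have "card C \<ge> 1"
    using fin(1) linear_code_zero[OF C] by (metis One_nat_def Suc_leI card_gt_0_iff empty_iff)
  ultimately have 1: "?q * S + ?q ^ n = ?q * ?q ^ n + card C * ?q ^ n"
    by simp
  have "S = (\<Sum>c\<in>C. \<Sum>v\<in>?V. if v \<bullet> c = 0 then 1 else 0)"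
    unfolding S_def using fin(2) by (simp add: sum.If_cases Int_def)
  also have "\<dots> = (\<Sum>v\<in>?V. \<Sum>c\<in>C. if v \<bullet> c = 0 then 1 else 0)"
    by (rule sum.swap)
  also have "\<dots> = (\<Sum>v\<in>?V. card {c \<in> C. c \<bullet> v = 0})"
  proof (rule sum.cong[OF refl])
    fix v assume v: "v \<in> ?V"
    have "{c \<in> C. c \<bullet> v = 0} = {c \<in> C. v \<bullet> c = 0}"
      using v sub comm_scalar_prod[of v n] by (metis subsetD)
    then show "(\<Sum>c\<in>C. if v \<bullet> c = 0 then 1 else 0) = card {c \<in> C. c \<bullet> v = 0}"
      using fin(1) by (simp add: sum.If_cases Int_def)
  qed
  finally have "?q * S = (\<Sum>v\<in>?V. ?q * card {c \<in> C. c \<bullet> v = 0})"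
    by (simp add: sum_distrib_left)
  also have "\<dots> = (\<Sum>v\<in>?V. if v \<in> ?D then ?q * card C else card C)"
  proof (rule sum.cong[OF refl])
    fix v assume v: "v \<in> ?V"
    have comm: "c \<bullet> v = v \<bullet> c" if "c \<in> C" for c
      using that v sub by (intro comm_scalar_prod) auto
    show "?q * card {c \<in> C. c \<bullet> v = 0} = (if v \<in> ?D then ?q * card C else card C)"
    proof (cases "v \<in> ?D")
      case True
      then have "{c \<in> C. c \<bullet> v = 0} = C"
        using comm by (auto simp: mem_dual_code)
      with True show ?thesis by simp
    next
      case False
      then have "\<exists>c\<in>C. c \<bullet> v \<noteq> 0"
        using comm v by (auto simp: mem_dual_code)
      from card_kernel_functional[OF C v this] False show ?thesis by simp
    qed
  qed
  also have "\<dots> = card ?D * (?q * card C) + card (?V - ?D) * card C"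
  proof -
    have "?V \<inter> {v. v \<in> ?D} = ?D" "?V \<inter> - {v. v \<in> ?D} = ?V - ?D"
      by (auto simp: mem_dual_code)
    then show ?thesis
      using fin(2) by (simp add: sum.If_cases)
  qed
  finally have "?q * S + card ?D * card C
      = card ?D * (?q * card C) + (card (?V - ?D) + card ?D) * card C"
    by (simp add: algebra_simps)
  moreover have "card (?V - ?D) + card ?D = ?q ^ n"
  proof -
    have "?D \<subseteq> ?V" by (auto simp: mem_dual_code)
    then show ?thesis
      using card_Diff_subset[OF fin(3)] card_mono[OF fin(2)] by (simp add: card_carrier_vec)
  qed
  ultimately have 2: "?q * S + card ?D * card C = card ?D * (?q * card C) + ?q ^ n * card C"
    by simp
  \<comment> \<open>Comparing the two counts leaves the common factor q - 1; as \<open>Suc p\<close>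
    it is visibly nonzero and cancels.\<close>
  obtain p where p: "?q = Suc (Suc p)"
    using two_le_card_field[where 'a = 'a] by (metis add_2_eq_Suc le_Suc_ex)
  have "?q * ?q ^ n + card ?D * card C = ?q * (card ?D * card C) + ?q ^ n"
    using 1 2 by (simp add: algebra_simps)
  then have "Suc p * ?q ^ n = Suc p * (card ?D * card C)"
    unfolding p by (simp add: algebra_simps)
  then show ?thesis
    unfolding mult_cancel1 by (simp add: mult.commute)
qed

lemma redundancy_eqI:
  fixes C :: "'a::{field, finite} vec set"
  assumes "linear_code n C" "card C * CARD('a) ^ r = CARD('a) ^ n"
  shows "redundancy n C = r"
proof -
  have "CARD('a) ^ (code_dim n C + r) = CARD('a) ^ n"
    using assms by (simp add: card_linear_code power_add)
  then have "code_dim n C + r = n"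
    using two_le_card_field[where 'a = 'a] by (simp)
  then show ?thesis
    by (simp add: redundancy_def)
qed

section \<open>Block supports\<close>

text \<open>The column space has q to the power of the rank elements, so a nonzero column forces
  positive rank. A single row is the scalar 1 times its entries, so the rank is at most 1.\<close>

lemma rank_mat_1:
  fixes A :: "'a::{field, finite} mat"
  assumes A: "A \<in> carrier_mat 1 N"
  shows "vec_space.rank 1 A = (if A = 0\<^sub>m 1 N then 0 else 1)"
proof (cases "A = 0\<^sub>m 1 N")
  case True
  then show ?thesis by (simp add: vec_space.rank_0I)
next
  case False
  interpret vec_space "TYPE('a)" 1 .
  let ?S = "span (set (cols A))"
  have S: "set (cols A) \<subseteq> carrier_vec 1"
    using A cols_dim[of A] by auto
  have code: "linear_code 1 ?S"
    using span_is_subspace[of "set (cols A)"] S by (simp add: linear_code_def)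
  have "code_dim 1 ?S = rank A"
    unfolding code_dim_def rank_def ..
  then have card: "card ?S = CARD('a) ^ rank A"
    using card_linear_code[OF code] by simp
  obtain j where j: "j < N" "A $$ (0, j) \<noteq> 0"
    using False A by (metis carrier_matD eq_matI index_zero_mat less_one)
  have "col A j \<in> ?S"
    using in_own_span[of "set (cols A)"] S A j(1) by (auto simp: cols_def)
  moreover have "col A j \<noteq> 0\<^sub>v 1"
    using j A by (metis carrier_matD index_col index_zero_vec(1) less_one)
  ultimately have "?S \<noteq> {0\<^sub>v 1}"
    by blast
  then have "rank A \<noteq> 0"
    using card linear_code_zero[OF code] by (metis card_1_singletonE power_0 singletonD)
  moreover have "rank A \<le> 1"
    by (rule rank_le_1_product_entries[OF A, of "\<lambda>_. 1" "\<lambda>c. A $$ (0, c)"]) (use A in auto)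
  ultimately show ?thesis
    using False by simp
qed

text \<open>The set is kept, and not only its size, because the distance arguments bound the support
  of a difference by a union and enlarge supports to pairs of blocks.\<close>

definition supp_blocks :: "nat \<Rightarrow> nat \<Rightarrow> 'a::zero vec \<Rightarrow> nat set" where
  "supp_blocks l N c = {i. i < l \<and> (\<exists>j<N. c $ (i * N + j) \<noteq> 0)}"

lemma finite_supp_blocks [simp]: "finite (supp_blocks l N c)"
  by (simp add: supp_blocks_def)

lemma wt_SR_eq_card_supp_blocks:
  fixes c :: "'a::{field, finite} vec"
  shows "wt_SR l N c = card (supp_blocks l N c)"
proof -
  have "block N c i = 0\<^sub>m 1 N \<longleftrightarrow> \<not> (\<exists>j<N. c $ (i * N + j) \<noteq> 0)" for i
    by (auto simp: block_def mat_eq_iff)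
  then have "vec_space.rank 1 (block N c i) = (if \<exists>j<N. c $ (i * N + j) \<noteq> 0 then 1 else 0)" for i
    by (subst rank_mat_1[of _ N]) (auto simp: block_def)
  then show ?thesis
    by (simp add: wt_SR_def supp_blocks_def sum.If_cases Int_def conj_commute)
qed

text \<open>The zero code fits without a case distinction: its infimum is infinite and the right
  side is vacuous.\<close>

lemma le_d_SR_iff:
  fixes C :: "'a::{field, finite} vec set"
  shows "enat k \<le> d_SR l N C \<longleftrightarrow> (\<forall>c\<in>C - {0\<^sub>v (l * N)}. k \<le> card (supp_blocks l N c))"
  by (simp add: d_SR_def le_INF_iff wt_SR_eq_card_supp_blocks)

lemma vec_eq_zero_if_supp_blocks_empty:
  assumes "v \<in> carrier_vec (l * N)" "supp_blocks l N v = {}"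
  shows "v = 0\<^sub>v (l * N)"
proof (rule eq_vecI)
  fix t assume t: "t < dim_vec (0\<^sub>v (l * N) :: 'a vec)"
  then have "t < l * N" "N > 0" by (auto intro: gr0I)
  then have "t div N < l" "t mod N < N"
    by (auto simp: less_mult_imp_div_less)
  moreover have "t = t div N * N + t mod N" by simp
  ultimately have "v $ t = 0"
    using assms(2) unfolding supp_blocks_def by (metis (mono_tags, lifting) empty_Collect_eq)
  then show "v $ t = 0\<^sub>v (l * N) $ t"
    using t by simp
qed (use assms in auto)

section \<open>Vectors supported on a single block\<close>

definition block_emb :: "nat \<Rightarrow> nat \<Rightarrow> nat \<Rightarrow> 'a::zero vec \<Rightarrow> 'a vec" where
  "block_emb l N i x = vec (l * N) (\<lambda>t. if t div N = i then x $ (t mod N) else 0)"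

lemma block_emb_carrier [simp]: "block_emb l N i x \<in> carrier_vec (l * N)"
  by (simp add: block_emb_def)

lemma block_index_less:
  assumes "i < l" "j < (N::nat)"
  shows "i * N + j < l * N"
proof -
  have "i * N + j < (i + 1) * N" using assms by simp
  also have "\<dots> \<le> l * N" using assms by (intro mult_le_mono1) simp
  finally show ?thesis .
qed

lemma block_emb_index:
  assumes "k < l" "j < N"
  shows "block_emb l N i x $ (k * N + j) = (if k = i then x $ j else 0)"
  using assms block_index_less[OF assms] by (simp add: block_emb_def)

lemma block_emb_inject:
  assumes "i < l" "x \<in> carrier_vec N" "y \<in> carrier_vec N"
    and "block_emb l N i x = block_emb l N i y"
  shows "x = y"
  using assms by (metis (no_types, lifting) block_emb_index carrier_vecD eq_vecI)

lemma supp_blocks_subset: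
  assumes "\<And>k j. k < l \<Longrightarrow> k \<notin> B \<Longrightarrow> j < N \<Longrightarrow> v $ (k * N + j) = 0"
  shows "supp_blocks l N v \<subseteq> B"
  using assms by (auto simp: supp_blocks_def)

text \<open>\<open>E\<close> consists of zero and all nonzero vectors living in one block where
  \<open>c\<close> vanishes. Differences of its elements have weight at most 2, so they represent
  distinct cosets of the dual. All these cosets lie in the hyperplane orthogonal to
  \<open>c\<close>, which is a union of \<open>q ^ (r - 1)\<close> cosets.\<close>

lemma card_zero_blocks_bound:
  fixes C :: "'a::{field, finite} vec set"
  assumes C: "linear_code (l * N) C"
    and card: "card C = CARD('a) ^ r" and r: "r > 0"
    and d: "3 \<le> d_SR l N (dual_code (l * N) C)"
    and c: "c \<in> C" "c \<noteq> 0\<^sub>v (l * N)"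
  shows "1 + (l - card (supp_blocks l N c)) * (CARD('a) ^ N - 1) \<le> CARD('a) ^ (r - 1)"
proof -
  let ?q = "CARD('a)" and ?n = "l * N" and ?D = "dual_code (l * N) C"
  define Z where "Z = {..<l} - supp_blocks l N c"
  define Y where "Y = carrier_vec N - {0\<^sub>v N :: 'a vec}"
  define E where "E = insert (0\<^sub>v ?n) ((\<lambda>(i, x). block_emb l N i x) ` (Z \<times> Y))"
  let ?H = "{v \<in> carrier_vec ?n. v \<bullet> c = 0}"
  note sub = linear_code_subset[OF C]
  note D = linear_code_dual_code[OF sub]
  have cc: "c \<in> carrier_vec ?n" using c sub by auto
  have fin: "finite Z" "finite Y" "finite E"
    by (auto simp: Z_def Y_def E_def finite_carrier_vec)
  have cardZ: "card Z = l - card (supp_blocks l N c)"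
    unfolding Z_def by (subst card_Diff_subset) (auto simp: supp_blocks_def)
  have cardY: "card Y = ?q ^ N - 1"
    unfolding Y_def by (subst card_Diff_subset) (auto simp: card_carrier_vec)
  \<comment> \<open>In block \<open>i\<close> the left side reads \<open>x\<close>, which is
    nonzero, and the right side reads zero.\<close>
  have nz: "block_emb l N i x \<noteq> block_emb l N j y"
    if "i < l" "i \<noteq> j" "x \<in> Y" for i j x y
  proof
    assume eq: "block_emb l N i x = block_emb l N j y"
    have "x = 0\<^sub>v N"
    proof (rule eq_vecI)
      fix k assume "k < dim_vec (0\<^sub>v N :: 'a vec)"
      then have k: "k < N" by simp
      have "block_emb l N i x $ (i * N + k) = block_emb l N j y $ (i * N + k)"
        by (simp add: eq)
      then show "x $ k = 0\<^sub>v N $ k"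
        using that k by (simp add: block_emb_index)
    qed (use that in \<open>auto simp: Y_def\<close>)
    then show False using that by (simp add: Y_def)
  qed
  have zero: "block_emb l N i (0\<^sub>v N :: 'a vec) = 0\<^sub>v ?n" for i
  proof (rule eq_vecI)
    fix t assume "t < dim_vec (0\<^sub>v ?n :: 'a vec)"
    moreover from this have "N > 0" by (auto intro: gr0I)
    ultimately show "block_emb l N i (0\<^sub>v N :: 'a vec) $ t = (0\<^sub>v ?n :: 'a vec) $ t"
      by (simp add: block_emb_def)
  qed (simp add: block_emb_def)
  have inj: "inj_on (\<lambda>(i, x). block_emb l N i x) (Z \<times> Y)"
  proof (rule inj_onI, clarify)
    fix i x j y assume *: "i \<in> Z" "x \<in> Y" "j \<in> Z" "y \<in> Y"
      and eq: "block_emb l N i x = block_emb l N j y"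
    then have "i = j" using nz[of i j x y] by (auto simp: Z_def)
    then show "i = j \<and> x = y"
      using block_emb_inject[of i l x N y] * eq by (auto simp: Z_def Y_def)
  qed
  have "0\<^sub>v ?n \<notin> (\<lambda>(i, x). block_emb l N i x) ` (Z \<times> Y)"
  proof clarify
    fix i x assume *: "i \<in> Z" "x \<in> Y" and "0\<^sub>v ?n = block_emb l N i x"
    then have "block_emb l N i (0\<^sub>v N) = block_emb l N i x" by (simp add: zero)
    then have "0\<^sub>v N = x"
      using block_emb_inject[of i l "0\<^sub>v N" N x] * by (auto simp: Z_def Y_def)
    then show False using * by (simp add: Y_def)
  qed
  then have cardE: "card E = 1 + (l - card (supp_blocks l N c)) * (?q ^ N - 1)"
    unfolding E_def using fin card_image[OF inj] cardZ cardY
    by (simp add: card_cartesian_product)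
  have E_carrier: "e \<in> carrier_vec ?n" if "e \<in> E" for e
    using that by (auto simp: E_def)
  \<comment> \<open>The second alternative covers the zero vector, also when \<open>Z\<close> is
    empty.\<close>
  have E_supp: "\<exists>i. supp_blocks l N e \<subseteq> {i} \<and> i \<in> Z \<or> supp_blocks l N e = {}" if "e \<in> E" for e
    using that
    by (force simp: E_def supp_blocks_def block_emb_index block_index_less split: if_splits)
  have E_card: "card (supp_blocks l N e) \<le> 1" if e: "e \<in> E" for e
  proof -
    obtain i where "supp_blocks l N e \<subseteq> {i}"
      using E_supp[OF e] by blast
    then show ?thesis
      using card_mono[of "{i}"] by simp
  qed
  \<comment> \<open>Each term vanishes: in the blocks of \<open>Z\<close> because of
    \<open>c\<close>, in all others because of \<open>e\<close>.\<close>
  have orth: "e \<bullet> c = 0" if "e \<in> E" for e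
    unfolding scalar_prod_def
  proof (rule sum.neutral, rule ballI)
    fix t assume "t \<in> {0..<dim_vec c}"
    then have t: "t < l * N" "N > 0" using cc by (auto intro: gr0I)
    define k j where "k = t div N" and "j = t mod N"
    have kj: "k < l" "j < N" "t = k * N + j"
      using t by (auto simp: k_def j_def less_mult_imp_div_less)
    show "e $ t * c $ t = 0"
    proof (cases "k \<in> Z")
      case True
      then have "c $ t = 0" using kj by (auto simp: Z_def supp_blocks_def)
      then show ?thesis by simp
    next
      case False
      then have "k \<notin> supp_blocks l N e"
        using E_supp[OF that] by auto
      then have "e $ t = 0" using kj by (auto simp: supp_blocks_def)
      then show ?thesis by simp
    qed
  qed
  have E_unique: "e = e'" if "e \<in> E" "e' \<in> E" "e - e' \<in> ?D" for e e'
  proof -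
    define B B' where "B = supp_blocks l N e" and "B' = supp_blocks l N e'"
    have B: "card B \<le> 1" "card B' \<le> 1" "finite B" "finite B'"
      using E_card that by (auto simp: B_def B'_def)
    have "supp_blocks l N (e - e') \<subseteq> B \<union> B'"
    proof (rule supp_blocks_subset)
      fix k j assume kj: "k < l" "k \<notin> B \<union> B'" "j < N"
      then have "e $ (k * N + j) = 0" "e' $ (k * N + j) = 0"
        by (auto simp: B_def B'_def supp_blocks_def)
      then show "(e - e') $ (k * N + j) = 0"
        using block_index_less[OF kj(1,3)] E_carrier[OF that(2)] by auto
    qed
    then have "card (supp_blocks l N (e - e')) \<le> card (B \<union> B')"
      using B by (intro card_mono) auto
    also have "\<dots> \<le> 2"
      using card_Un_le[of B B'] B by simp
    finally have "card (supp_blocks l N (e - e')) < 3" by simp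
    moreover have "\<forall>v\<in>?D - {0\<^sub>v ?n}. 3 \<le> card (supp_blocks l N v)"
      using d le_d_SR_iff[of 3 l N ?D] by (simp add: numeral_eq_enat)
    ultimately have "e - e' = 0\<^sub>v ?n"
      using that(3) by (meson Diff_iff not_less singletonD)
    moreover have "e = (e - e') + e'"
      using E_carrier[OF that(1)] E_carrier[OF that(2)] by auto
    ultimately show ?thesis
      using E_carrier[OF that(2)] by simp
  qed
  have "inj_on (\<lambda>(e, v). e + v) (E \<times> ?D)"
  proof (rule inj_onI, clarify)
    fix e v e' v' assume *: "e \<in> E" "v \<in> ?D" "e' \<in> E" "v' \<in> ?D" and eq: "e + v = e' + v'"
    have carr: "e \<in> carrier_vec ?n" "e' \<in> carrier_vec ?n" "v \<in> carrier_vec ?n" "v' \<in> carrier_vec ?n"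
      using * E_carrier linear_code_subset[OF D] by auto
    have "e - e' = v' - v"
    proof (rule eq_vecI)
      fix t assume t: "t < dim_vec (v' - v)"
      have "(e + v) $ t = (e' + v') $ t" by (simp add: eq)
      then show "(e - e') $ t = (v' - v) $ t"
        using t carr by (auto simp: algebra_simps)
    qed (use carr in auto)
    then have "e - e' \<in> ?D"
      using * linear_code_minus[OF D] by auto
    then have e: "e = e'" using E_unique * by blast
    have "v = v'"
    proof (rule eq_vecI)
      fix t assume t: "t < dim_vec v'"
      have "(e + v) $ t = (e + v') $ t" using eq e by simp
      then show "v $ t = v' $ t"
        using t carr by auto
    qed (use carr in auto)
    with e show "e = e' \<and> v = v'" by simp
  qed
  moreover have "(\<lambda>(e, v). e + v) ` (E \<times> ?D) \<subseteq> ?H"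
  proof clarify
    fix e v assume *: "e \<in> E" "v \<in> ?D"
    have carr: "e \<in> carrier_vec ?n" "v \<in> carrier_vec ?n"
      using * E_carrier linear_code_subset[OF D] by auto
    have "(e + v) \<bullet> c = e \<bullet> c + v \<bullet> c"
      using carr cc by (intro add_scalar_prod_distrib)
    also have "\<dots> = 0"
      using orth[OF *(1)] * c by (simp add: mem_dual_code)
    finally show "e + v \<in> carrier_vec ?n \<and> (e + v) \<bullet> c = 0"
      using carr by simp
  qed
  moreover have "finite ?H"
    by (rule finite_subset[OF _ finite_carrier_vec[of ?n]]) auto
  ultimately have "card (E \<times> ?D) \<le> card ?H"
    by (rule card_inj_on_le)
  then have le: "card E * card ?D \<le> card ?H"
    by (simp add: card_cartesian_product)
  \<comment> \<open>Both sides are the number of all vectors: the hyperplane holds one in q of them,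
    and the code and its dual have complementary sizes.\<close>
  have "?q * card ?H = ?q ^ r * card ?D"
    using card_hyperplane[OF cc c(2)] card_mult_card_dual_code[OF C] card by simp
  also have "\<dots> = ?q * (?q ^ (r - 1) * card ?D)"
    using power_minus_mult[OF r, of ?q] by (metis mult.assoc mult.commute)
  finally have "card ?H = ?q ^ (r - 1) * card ?D"
    using two_le_card_field[where 'a = 'a] by simp
  with le have "card E * card ?D \<le> ?q ^ (r - 1) * card ?D" by simp
  moreover have "card ?D > 0"
    using linear_code_zero[OF D] finite_subset[OF linear_code_subset[OF D] finite_carrier_vec]
    by (auto simp: card_gt_0_iff)
  ultimately have "card E \<le> ?q ^ (r - 1)" by simp
  then show ?thesis
    unfolding cardE .
qed

section \<open>Matrices from the field with \<open>q ^ M\<close> elements\<close>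

text \<open>The polynomial \<open>(1 + X) ^ q - 1 - X ^ q\<close> has degree less than \<open>q\<close> and vanishes on all
  of the field, so its coefficients are zero.\<close>

lemma of_nat_choose_card_eq_0:
  assumes i: "0 < i" "i < CARD('a::{field, finite})"
  shows "(of_nat (CARD('a) choose i) :: 'a) = 0"
proof -
  let ?q = "CARD('a)"
  define P where "P = (\<Sum>i\<in>{0<..<?q}. Polynomial.monom (of_nat (?q choose i) :: 'a) i)"
  have coeff: "Polynomial.coeff P j = (if 0 < j \<and> j < ?q then of_nat (?q choose j) else 0)" for j
    by (simp add: P_def coeff_sum)
  have "P = 0"
  proof (rule ccontr)
    assume "P \<noteq> 0"
    have "poly P a = 0" for a
    proof -
      have "1 + a = (a + 1) ^ ?q"
        by (simp add: finite_field_pow_card add.commute)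
      also have "\<dots> = (\<Sum>k\<le>?q. of_nat (?q choose k) * a ^ k)"
        by (subst binomial_ring) simp
      also have "{..?q} = insert 0 (insert ?q {0<..<?q})"
        using two_le_card_field[where 'a = 'a] by auto
      also have "(\<Sum>k\<in>\<dots>. of_nat (?q choose k) * a ^ k) = 1 + a + poly P a"
        using two_le_card_field[where 'a = 'a]
        by (simp add: P_def poly_sum poly_monom finite_field_pow_card)
      finally show ?thesis by simp
    qed
    then have "card (UNIV :: 'a set) \<le> Polynomial.degree P"
      using card_poly_roots_bound[OF \<open>P \<noteq> 0\<close>] by simp
    moreover have "Polynomial.degree P \<le> ?q - 1"
      by (rule degree_le) (auto simp: coeff)
    ultimately show False
      using two_le_card_field[where 'a = 'a] by simp
  qed
  then show ?thesis
    using coeff[of i] i by simp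
qed

text \<open>The middle binomial coefficients of exponent q vanish in the base field, hence in its
  closure; this gives additivity of the q-th power, which is then iterated.\<close>

lemma alg_closure_add_pow_card:
  fixes x y :: "'a::{field, finite} alg_closure"
  shows "(x + y) ^ (CARD('a) ^ M) = x ^ (CARD('a) ^ M) + y ^ (CARD('a) ^ M)"
proof -
  let ?q = "CARD('a)"
  have frobenius: "(x + y) ^ ?q = x ^ ?q + y ^ ?q" for x y :: "'a alg_closure"
  proof -
    have "(of_nat (?q choose k) :: 'a alg_closure) = 0" if "k \<in> {0<..<?q}" for k
      using of_nat_choose_card_eq_0[of k, where 'a = 'a] that
      by (metis greaterThanLessThan_iff to_ac_0 to_ac_of_nat)
    moreover have "(x + y) ^ ?q = (\<Sum>k\<le>?q. of_nat (?q choose k) * x ^ k * y ^ (?q - k))"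
      by (rule binomial_ring)
    moreover have "{..?q} = insert 0 (insert ?q {0<..<?q})"
      using two_le_card_field[where 'a = 'a] by auto
    ultimately show ?thesis
      using two_le_card_field[where 'a = 'a] by simp
  qed
  show ?thesis
    by (induction M) (simp_all add: power_mult frobenius mult.commute[of ?q])
qed

text \<open>The polynomial \<open>X ^ Q - X\<close> splits into \<open>Q\<close> linear factors.
  Since \<open>Q\<close> is zero in the field, its derivative is the constant -1, so no root is
  repeated.\<close>

lemma card_roots_pow_minus_self:
  assumes Q: "Q \<ge> 2" "(of_nat Q :: 'a::alg_closed_field) = 0"
  shows "card {x :: 'a. x ^ Q = x} = Q"
proof -
  define p :: "'a poly" where "p = Polynomial.monom 1 Q - [:0, 1:]"
  have coeff: "Polynomial.coeff p i = (if i = Q then 1 else if i = 1 then - 1 else 0)" for i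
    using Q by (auto simp: p_def coeff_pCons split: nat.splits)
  have deg: "Polynomial.degree p = Q"
    using Q by (intro antisym degree_le le_degree) (auto simp: coeff)
  then have p0: "p \<noteq> 0" using Q by auto
  have poly: "poly p x = x ^ Q - x" for x
    by (simp add: p_def poly_monom)
  have "pderiv p = [:- 1:]"
    using Q by (simp add: p_def pderiv_diff pderiv_monom pderiv_pCons)
  then have ord: "order x p = 1" if "poly p x = 0" for x
  proof -
    have "\<not> [:- x, 1:] ^ 2 dvd p"
    proof
      assume "[:- x, 1:] ^ 2 dvd p"
      then obtain r where "p = [:- x, 1:] * ([:- x, 1:] * r)"
        by (metis dvdE mult.assoc power2_eq_square)
      then have "poly (pderiv p) x = 0"
        by (simp add: pderiv_mult del: mult_pCons_left)
      then show False
        using \<open>pderiv p = [:- 1:]\<close> by simp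
    qed
    then have "order x p < 2"
      using order_divides[of x 2 p] p0 by auto
    moreover have "order x p \<noteq> 0"
      using that p0 order_root[of p x] by auto
    ultimately show ?thesis by simp
  qed
  obtain A where A: "size A = Polynomial.degree p" "p = smult (Polynomial.lead_coeff p) (\<Prod>x\<in>#A. [:- x, 1:])"
    using alg_closed_imp_factorization[OF p0] by blast
  have "proots p = A"
  proof -
    have "proots p = proots (\<Prod>x\<in>#A. [:- x, 1:])"
      using p0 by (subst A(2)) simp
    also have "\<dots> = A"
    proof (induction A)
      case (add x A)
      have "(\<Prod>x\<in>#A. [:- x, 1:]) \<noteq> 0"
        by (auto simp: prod_mset_zero_iff)
      then have "proots ([:- x, 1:] * (\<Prod>x\<in>#A. [:- x, 1:])) = proots [:- x, 1:] + proots (\<Prod>x\<in>#A. [:- x, 1:])"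
        by (intro proots_mult) auto
      then show ?case
        using add by (simp del: mult_pCons_left)
    qed simp
    finally show ?thesis .
  qed
  have "Q = size (proots p)"
    using A deg \<open>proots p = A\<close> by simp
  also have "\<dots> = (\<Sum>x\<in>set_mset (proots p). order x p)"
    using p0 by (simp add: size_multiset_overloaded_eq)
  also have "\<dots> = card {x. poly p x = 0}"
    using p0 ord by simp
  finally show ?thesis
    by (simp add: poly)
qed

text \<open>\<open>K\<close> is the field with \<open>q ^ M\<close> elements, realised as the fixed
  points of the iterated Frobenius map. It is a set inside the algebraic closure because its size
  depends on the variable \<open>M\<close>.\<close>

context
  fixes M :: nat and K :: "'a::{field, finite} alg_closure set"
  assumes M: "M > 0"
  defines "K \<equiv> {x. x ^ (CARD('a) ^ M) = x}"
begin

lemma card_subfield: "card K = CARD('a) ^ M"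
  unfolding K_def
proof (rule card_roots_pow_minus_self)
  show "CARD('a) ^ M \<ge> 2"
    using two_le_card_field[where 'a = 'a] self_le_power[of "CARD('a)" M] M by linarith
  \<comment> \<open>This is the binomial coefficient \<open>q choose 1\<close>.\<close>
  have "(of_nat (CARD('a)) :: 'a) = 0"
    using of_nat_choose_card_eq_0[of 1, where 'a = 'a] two_le_card_field[where 'a = 'a] by simp
  then have "(of_nat (CARD('a)) :: 'a alg_closure) = 0"
    by (metis to_ac_0 to_ac_of_nat)
  then show "(of_nat (CARD('a) ^ M) :: 'a alg_closure) = 0"
    using M by simp
qed

lemma subfield_mult: "x \<in> K \<Longrightarrow> y \<in> K \<Longrightarrow> x * y \<in> K"
  by (simp add: K_def power_mult_distrib)

lemma subfield_to_ac: "to_ac a \<in> K"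
proof -
  have "a ^ (CARD('a) ^ M) = a"
    by (induction M) (simp_all add: power_mult finite_field_pow_card mult.commute[of "CARD('a)"])
  then show ?thesis
    by (simp add: K_def flip: to_ac_power)
qed

lemma subfield_sum: "(\<And>i. i \<in> I \<Longrightarrow> f i \<in> K) \<Longrightarrow> sum f I \<in> K"
  using M by (induction I rule: infinite_finite_induct) (auto simp: K_def alg_closure_add_pow_card)

text \<open>A basis over the base field is found greedily: fewer than \<open>M\<close> elements have
  fewer than \<open>q ^ M\<close> combinations, so they miss some element of \<open>K\<close>. Once
  \<open>M\<close> independent elements are reached, their \<open>q ^ M\<close> distinct
  combinations exhaust \<open>K\<close>.\<close>

lemma ex_subfield_basis:
  obtains b where "\<And>i. i < M \<Longrightarrow> b i \<in> K"
    and "\<And>c. (\<Sum>i<M. to_ac (c i) * b i) = 0 \<Longrightarrow> \<forall>i<M. c i = 0"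
    and "\<And>y. y \<in> K \<Longrightarrow> \<exists>c. y = (\<Sum>i<M. to_ac (c i) * b i)"
proof -
  have finK: "finite K"
    using card_subfield by (metis card.infinite finite_UNIV_card_ge_0 finite_class.finite_UNIV
        neq0_conv power_eq_0_iff)
  let ?comb = "\<lambda>m b c. \<Sum>i<m. to_ac (c i) * b i"
  define indep where "indep m b \<longleftrightarrow> (\<forall>c :: nat \<Rightarrow> 'a. ?comb m b c = 0 \<longrightarrow> (\<forall>i<m. c i = 0))" for m b
  have "\<exists>b. (\<forall>i<m. b i \<in> K) \<and> indep m b" if "m \<le> M" for m
    using that
  proof (induction m)
    case 0
    then show ?case by (auto simp: indep_def)
  next
    case (Suc m)
    then obtain b where b: "\<forall>i<m. b i \<in> K" "indep m b" by auto
    let ?S = "?comb m b ` ({..<m} \<rightarrow>\<^sub>E UNIV)"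
    have "card ?S \<le> CARD('a) ^ m"
      using card_image_le[of "{..<m} \<rightarrow>\<^sub>E (UNIV :: 'a set)" "?comb m b"]
      by (simp add: card_PiE finite_PiE)
    also have "\<dots> < card K"
      using Suc.prems two_le_card_field[where 'a = 'a]
      by (simp add: card_subfield)
    finally have "\<not> K \<subseteq> ?S"
      using card_mono[of ?S K] by (meson finite_imageI finite_PiE finite_lessThan finite_class.finite_UNIV not_less)
    then obtain y where y: "y \<in> K" "y \<notin> ?S" by blast
    have y': "y \<noteq> ?comb m b c" for c
    proof
      assume "y = ?comb m b c"
      then have "y = ?comb m b (restrict c {..<m})" by simp
      then have "y \<in> ?S"
        by (intro image_eqI[of y "?comb m b" "restrict c {..<m}"]) auto
      then show False using y(2) by contradiction
    qed
    have "indep (Suc m) (b(m := y))"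
      unfolding indep_def
    proof (intro allI impI)
      fix c :: "nat \<Rightarrow> 'a" and i
      assume sum: "?comb (Suc m) (b(m := y)) c = 0" and i: "i < Suc m"
      then have sum': "?comb m b c + to_ac (c m) * y = 0" by simp
      \<comment> \<open>Otherwise the relation could be solved for \<open>y\<close>, which was
        chosen outside all combinations.\<close>
      have "c m = 0"
      proof (rule ccontr)
        assume cm: "c m \<noteq> 0"
        have "y = - ?comb m b c / to_ac (c m)"
          using sum' cm by (simp add: field_simps eq_neg_iff_add_eq_0)
        also have "\<dots> = ?comb m b (\<lambda>i. - c i / c m)"
          by (simp add: sum_negf sum_divide_distrib)
        finally show False using y'[of "\<lambda>i. - c i / c m"] by contradiction
      qed
      with sum' b(2) i show "c i = 0"
        by (auto simp: indep_def less_Suc_eq)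
    qed
    moreover have "\<forall>i<Suc m. (b(m := y)) i \<in> K"
      using b(1) y(1) by (simp add: less_Suc_eq)
    ultimately show ?case by blast
  qed
  then obtain b where b: "\<And>i. i < M \<Longrightarrow> b i \<in> K" "indep M b" by blast
  let ?F = "{..<M} \<rightarrow>\<^sub>E (UNIV :: 'a set)"
  have "inj_on (?comb M b) ?F"
  proof (rule inj_onI)
    fix c c' assume c: "c \<in> ?F" "c' \<in> ?F" and "?comb M b c = ?comb M b c'"
    then have "?comb M b (\<lambda>i. c i - c' i) = 0"
      by (simp add: left_diff_distrib sum_subtractf)
    from b(2)[unfolded indep_def, THEN spec, THEN mp, OF this]
    have "\<forall>i<M. c i = c' i" by simp
    then show "c = c'" using c by (intro PiE_ext) auto
  qed
  then have "card (?comb M b ` ?F) = card K"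
    by (simp add: card_image card_PiE card_subfield)
  moreover have "?comb M b ` ?F \<subseteq> K"
    using b(1) by (auto intro!: subfield_sum subfield_mult subfield_to_ac)
  ultimately have "?comb M b ` ?F = K"
    using card_subset_eq[OF finK] by blast
  then have spans: "\<exists>c. y = ?comb M b c" if "y \<in> K" for y
    using imageE[of y "?comb M b" ?F] that by metis
  show ?thesis
    by (rule that[of b]) (use b spans in \<open>simp_all add: indep_def\<close>)
qed

end

text \<open>The matrices are those of multiplication by the elements of the field of size \<open>q ^ M\<close>,
  restricted to a subspace of dimension \<open>N\<close>.\<close>

lemma ex_full_rank_differences:
  assumes N: "0 < N" "N \<le> M"
  obtains R :: "'a::{field, finite} mat set"
  where "R \<subseteq> carrier_mat M N" "card R = CARD('a) ^ M"
    and "\<And>A B x. \<lbrakk>A \<in> R; B \<in> R; A \<noteq> B; x \<in> carrier_vec N; A *\<^sub>v x = B *\<^sub>v x\<rbrakk> \<Longrightarrow> x = 0\<^sub>v N"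
proof -
  have M: "M > 0" using N by simp
  define K where "K = {x :: 'a alg_closure. x ^ (CARD('a) ^ M) = x}"
  note K = card_subfield[OF M, where 'a = 'a, folded K_def]
    subfield_mult[OF M, where 'a = 'a, folded K_def]
  obtain b where b: "\<And>i. i < M \<Longrightarrow> b i \<in> K"
    and indep: "\<And>c :: nat \<Rightarrow> 'a. (\<Sum>i<M. to_ac (c i) * b i) = 0 \<Longrightarrow> \<forall>i<M. c i = 0"
    and spans: "\<And>y. y \<in> K \<Longrightarrow> \<exists>c. y = (\<Sum>i<M. to_ac (c i) * b i)"
    by (fact ex_subfield_basis[OF M, where 'a = 'a, folded K_def])
  define c where "c y = (SOME c. y = (\<Sum>i<M. to_ac (c i) * b i))" for y
  have c: "y = (\<Sum>i<M. to_ac (c y i) * b i)" if "y \<in> K" for y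
    unfolding c_def by (rule someI_ex[OF spans[OF that]])
  \<comment> \<open>\<open>T a\<close> is the matrix of multiplication by \<open>a\<close>, from the
    span of the first \<open>N\<close> basis elements into the whole field; \<open>\<beta>\<close>
    turns coordinates back into field elements.\<close>
  define T where "T a = mat M N (\<lambda>(i, j). c (a * b j) i)" for a
  define \<beta> where "\<beta> m v = (\<Sum>i<m. to_ac (v $ i) * b i)" for m and v :: "'a vec"
  have \<beta>_T: "\<beta> M (T a *\<^sub>v x) = a * \<beta> N x" if a: "a \<in> K" and x: "x \<in> carrier_vec N" for a x
  proof -
    have "\<beta> M (T a *\<^sub>v x) = (\<Sum>i<M. \<Sum>j<N. to_ac (c (a * b j) i) * to_ac (x $ j) * b i)"
      unfolding \<beta>_def
    proof (rule sum.cong[OF refl])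
      fix i assume i: "i \<in> {..<M}"
      then have "(T a *\<^sub>v x) $ i = (\<Sum>j<N. c (a * b j) i * x $ j)"
        using x by (simp add: T_def scalar_prod_def lessThan_atLeast0)
      then show "to_ac ((T a *\<^sub>v x) $ i) * b i
          = (\<Sum>j<N. to_ac (c (a * b j) i) * to_ac (x $ j) * b i)"
        by (simp add: to_ac_sum sum_distrib_right)
    qed
    also have "\<dots> = (\<Sum>j<N. to_ac (x $ j) * (\<Sum>i<M. to_ac (c (a * b j) i) * b i))"
      by (subst sum.swap) (simp add: sum_distrib_left mult_ac)
    also have "\<dots> = (\<Sum>j<N. to_ac (x $ j) * (a * b j))"
      using c[symmetric] K(2)[OF a b] N by (intro sum.cong) auto
    finally show ?thesis
      by (simp add: \<beta>_def sum_distrib_left mult_ac)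
  qed
  have \<beta>_zero: "x = 0\<^sub>v N" if "x \<in> carrier_vec N" "\<beta> N x = 0" for x
  proof -
    \<comment> \<open>Padding with zeros makes independence of the full basis applicable to its
      first \<open>N\<close> elements.\<close>
    have "(\<Sum>i<M. to_ac (if i < N then x $ i else 0) * b i) = \<beta> N x"
      unfolding \<beta>_def using N by (intro sum.mono_neutral_cong_right) auto
    then have "\<forall>i<M. (if i < N then x $ i else 0) = 0"
      using that(2) by (intro indep) simp
    then have "\<forall>i<N. x $ i = 0"
      using N by (metis less_le_trans)
    then show ?thesis
      using that(1) by (intro eq_vecI) auto
  qed
  have rank: "x = 0\<^sub>v N" if "a \<in> K" "a' \<in> K" "a \<noteq> a'" "x \<in> carrier_vec N" "T a *\<^sub>v x = T a' *\<^sub>v x"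
    for a a' x
  proof (rule \<beta>_zero)
    have "a * \<beta> N x = a' * \<beta> N x"
      using \<beta>_T that by metis
    then show "\<beta> N x = 0" using that by simp
  qed (use that in simp)
  show ?thesis
  proof (rule that[of "T ` K"])
    show "T ` K \<subseteq> carrier_mat M N"
      by (auto simp: T_def)
    have "unit_vec N 0 \<noteq> (0\<^sub>v N :: 'a vec)"
      using N by (metis index_unit_vec(2) index_zero_vec(1) zero_neq_one)
    then have "inj_on T K"
      using rank[of _ _ "unit_vec N 0"] by (intro inj_onI) (metis unit_vec_carrier)
    then show "card (T ` K) = CARD('a) ^ M"
      by (simp add: card_image K)
  qed (use rank in auto)
qed

section \<open>Partial spreads\<close>

text \<open>Each member is given by a matrix whose columns form a basis of it. The conditions say
  that the columns are independent and that distinct members meet only in zero. In this form the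
  members can serve directly as blocks of a parity check matrix.\<close>

definition partial_spread :: "nat \<Rightarrow> nat \<Rightarrow> 'a::field mat set \<Rightarrow> bool" where
  "partial_spread M N S \<longleftrightarrow> finite S \<and> S \<subseteq> carrier_mat M N \<and>
    (\<forall>u\<in>S. \<forall>x\<in>carrier_vec N. u *\<^sub>v x = 0\<^sub>v M \<longrightarrow> x = 0\<^sub>v N) \<and>
    (\<forall>u\<in>S. \<forall>u'\<in>S. \<forall>x\<in>carrier_vec N. \<forall>x'\<in>carrier_vec N.
      u \<noteq> u' \<longrightarrow> u *\<^sub>v x = u' *\<^sub>v x' \<longrightarrow> x = 0\<^sub>v N)"

text \<open>Taking for \<open>W\<close> the image of a parity check matrix will show that the matrix
  is onto, which makes the redundancy exact. Closure under addition and subtraction suffices since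
  each column space already contains its scalar multiples.\<close>

definition spans_space :: "nat \<Rightarrow> nat \<Rightarrow> 'a::field mat set \<Rightarrow> bool" where
  "spans_space M N S \<longleftrightarrow> (\<forall>W. (\<forall>u\<in>S. \<forall>x\<in>carrier_vec N. u *\<^sub>v x \<in> W) \<longrightarrow>
    (\<forall>v\<in>W. \<forall>w\<in>W. v + w \<in> W \<and> v - w \<in> W) \<longrightarrow> carrier_vec M \<subseteq> W)"

lemma unit_vec_0_neq_zero_vec: "N > 0 \<Longrightarrow> unit_vec N 0 \<noteq> (0\<^sub>v N :: 'a::zero_neq_one vec)"
  by (metis index_unit_vec(2) index_zero_vec(1) zero_neq_one)

text \<open>The subspaces \<open>{(x, A x)}\<close> for \<open>A\<close> in a set of matrices with full rank differences are added
  to a partial spread of the second summand.\<close>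

lemma partial_spread_extend:
  fixes S :: "'a::{field, finite} mat set"
  assumes N: "0 < N" "N \<le> M" and S: "partial_spread M N S"
  obtains S' :: "'a mat set" where "partial_spread (N + M) N S'" "spans_space (N + M) N S'"
    "card S' = CARD('a) ^ M + card S"
proof -
  obtain R :: "'a mat set" where R: "R \<subseteq> carrier_mat M N" "card R = CARD('a) ^ M"
    and diff: "\<And>A B x. \<lbrakk>A \<in> R; B \<in> R; A \<noteq> B; x \<in> carrier_vec N; A *\<^sub>v x = B *\<^sub>v x\<rbrakk> \<Longrightarrow> x = 0\<^sub>v N"
    by (fact ex_full_rank_differences[OF N, where 'a = 'a])
  have finR: "finite R"
    using R(2) by (intro card_ge_0_finite) simp
  have finS: "finite S" and S_carrier: "S \<subseteq> carrier_mat M N"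
    and S_inj: "\<And>u x. \<lbrakk>u \<in> S; x \<in> carrier_vec N; u *\<^sub>v x = 0\<^sub>v M\<rbrakk> \<Longrightarrow> x = 0\<^sub>v N"
    and S_disj: "\<And>u u' x x'. \<lbrakk>u \<in> S; u' \<in> S; x \<in> carrier_vec N; x' \<in> carrier_vec N;
      u \<noteq> u'; u *\<^sub>v x = u' *\<^sub>v x'\<rbrakk> \<Longrightarrow> x = 0\<^sub>v N"
    using S unfolding partial_spread_def by blast+
  define g where "g A = 1\<^sub>m N @\<^sub>r A" for A :: "'a mat"
  define h where "h u = 0\<^sub>m N N @\<^sub>r u" for u :: "'a mat"
  have g: "g A *\<^sub>v x = x @\<^sub>v A *\<^sub>v x" if "A \<in> R" "x \<in> carrier_vec N" for A x
    using mat_mult_append[of "1\<^sub>m N" N N A M x] that R by (auto simp: g_def)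
  have h: "h u *\<^sub>v x = 0\<^sub>v N @\<^sub>v u *\<^sub>v x" if "u \<in> S" "x \<in> carrier_vec N" for u x
  proof -
    have "0\<^sub>m N N *\<^sub>v x = (0\<^sub>v N :: 'a vec)"
      using that by (auto simp: scalar_prod_def)
    then show ?thesis
      using mat_mult_append[of "0\<^sub>m N N" N N u M x] that S_carrier by (auto simp: h_def)
  qed
  have Rx: "A *\<^sub>v x \<in> carrier_vec M" if "A \<in> R" "x \<in> carrier_vec N" for A x
    using that R by (intro mult_mat_vec_carrier[of _ M N]) auto
  have Sx: "u *\<^sub>v x \<in> carrier_vec M" if "u \<in> S" "x \<in> carrier_vec N" for u x
    using that S_carrier by (intro mult_mat_vec_carrier[of _ M N]) auto
  have app: "v @\<^sub>v w = v' @\<^sub>v w' \<longleftrightarrow> v = v' \<and> w = w'"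
    if "v \<in> carrier_vec N" "v' \<in> carrier_vec N" for v v' w w' :: "'a vec"
    using append_vec_eq[OF that] .
  \<comment> \<open>Any fixed nonzero vector would do; distinct matrices are told apart by their
    values on it.\<close>
  define e where "e = (unit_vec N 0 :: 'a vec)"
  have e: "e \<in> carrier_vec N" "e \<noteq> 0\<^sub>v N"
    using unit_vec_0_neq_zero_vec[OF N(1)] by (auto simp: e_def)
  have "inj_on g R"
  proof (rule inj_onI)
    fix A B assume AB: "A \<in> R" "B \<in> R" "g A = g B"
    then have "e @\<^sub>v A *\<^sub>v e = e @\<^sub>v B *\<^sub>v e"
      using g[of A e] g[of B e] e by simp
    then show "A = B"
      using diff[of A B e] AB e app[of e e] by auto
  qed
  have "inj_on h S"
  proof (rule inj_onI)
    fix u u' assume u: "u \<in> S" "u' \<in> S" "h u = h u'"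
    then have "0\<^sub>v N @\<^sub>v u *\<^sub>v e = 0\<^sub>v N @\<^sub>v u' *\<^sub>v e"
      using h[of u e] h[of u' e] e by simp
    then show "u = u'"
      using S_disj[of u u' e e] u e app[of "0\<^sub>v N" "0\<^sub>v N"] by auto
  qed
  have "g ` R \<inter> h ` S = {}"
  proof (rule ccontr)
    assume "g ` R \<inter> h ` S \<noteq> {}"
    then obtain A u where Au: "A \<in> R" "u \<in> S" "g A = h u" by auto
    then have "e @\<^sub>v A *\<^sub>v e = 0\<^sub>v N @\<^sub>v u *\<^sub>v e"
      using g[of A e] h[of u e] e by simp
    then show False
      using app[of e "0\<^sub>v N"] e by auto
  qed
  then have card: "card (g ` R \<union> h ` S) = CARD('a) ^ M + card S"
    using finR finS R(2) card_image[OF \<open>inj_on g R\<close>] card_image[OF \<open>inj_on h S\<close>]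
    by (simp add: card_Un_disjoint)
  have zero_app: "0\<^sub>v (N + M) = 0\<^sub>v N @\<^sub>v (0\<^sub>v M :: 'a vec)"
    by (rule eq_vecI) auto
  have "partial_spread (N + M) N (g ` R \<union> h ` S)"
    unfolding partial_spread_def
  proof (intro conjI ballI impI)
    show "finite (g ` R \<union> h ` S)"
      using finR finS by simp
    show "g ` R \<union> h ` S \<subseteq> carrier_mat (N + M) N"
      using R(1) S_carrier by (auto simp: g_def h_def intro!: carrier_append_rows)
    fix U and x :: "'a vec" assume U: "U \<in> g ` R \<union> h ` S" and x: "x \<in> carrier_vec N"
    show "x = 0\<^sub>v N" if "U *\<^sub>v x = 0\<^sub>v (N + M)"
      using U
    proof
      assume "U \<in> g ` R"
      then show ?thesis
        using that x g app[of x "0\<^sub>v N"] by (auto simp: zero_app)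
    next
      assume "U \<in> h ` S"
      then show ?thesis
        using that x h app[of "0\<^sub>v N" "0\<^sub>v N"] S_inj by (auto simp: zero_app)
    qed
    fix U' and x' :: "'a vec" assume U': "U' \<in> g ` R \<union> h ` S" and x': "x' \<in> carrier_vec N"
      and neq: "U \<noteq> U'" and eq: "U *\<^sub>v x = U' *\<^sub>v x'"
    \<comment> \<open>Two graphs have equal first components, so full rank differences apply. A
      graph and an old member agree only where the first component is zero. Two old members are
      handled by the given spread.\<close>
    consider (gg) A B where "A \<in> R" "B \<in> R" "U = g A" "U' = g B"
      | (gh) A u where "A \<in> R" "u \<in> S" "U = g A" "U' = h u"
      | (hg) A u where "A \<in> R" "u \<in> S" "U = h u" "U' = g A"
      | (hh) u u' where "u \<in> S" "u' \<in> S" "U = h u" "U' = h u'"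
      using U U' by blast
    then show "x = 0\<^sub>v N"
    proof cases
      case gg
      then have "x @\<^sub>v A *\<^sub>v x = x' @\<^sub>v B *\<^sub>v x'"
        using eq x x' g by metis
      then have "x = x'" "A *\<^sub>v x = B *\<^sub>v x'"
        using app[OF x x'] by auto
      then show ?thesis
        using diff[of A B x] gg neq x by auto
    next
      case gh
      then have "x @\<^sub>v A *\<^sub>v x = 0\<^sub>v N @\<^sub>v u *\<^sub>v x'"
        using eq x x' g h by metis
      then show ?thesis
        using app[OF x, of "0\<^sub>v N"] by auto
    next
      case hg
      then have "0\<^sub>v N @\<^sub>v u *\<^sub>v x = x' @\<^sub>v A *\<^sub>v x'"
        using eq x x' g h by metis
      then have "x' = 0\<^sub>v N" "u *\<^sub>v x = A *\<^sub>v x'"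
        using app[OF _ x', of "0\<^sub>v N"] by auto
      moreover have "A *\<^sub>v 0\<^sub>v N = 0\<^sub>v M"
      proof -
        have "A \<in> carrier_mat M N" using hg(1) R(1) by blast
        then show ?thesis by (intro eq_vecI) (auto simp: scalar_prod_def)
      qed
      ultimately show ?thesis
        using S_inj[OF hg(2) x] by simp
    next
      case hh
      then have "0\<^sub>v N @\<^sub>v u *\<^sub>v x = 0\<^sub>v N @\<^sub>v u' *\<^sub>v x'"
        using eq x x' h by metis
      then have "u *\<^sub>v x = u' *\<^sub>v x'"
        using app[of "0\<^sub>v N" "0\<^sub>v N"] by auto
      then show ?thesis
        using S_disj[of u u' x x'] hh neq x x' by auto
    qed
  qed
  moreover have "spans_space (N + M) N (g ` R \<union> h ` S)"
    unfolding spans_space_def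
  proof (intro allI impI subsetI)
    fix W :: "'a vec set" and v :: "'a vec"
    assume gen: "\<forall>U\<in>g ` R \<union> h ` S. \<forall>x\<in>carrier_vec N. U *\<^sub>v x \<in> W"
      and closed: "\<forall>v\<in>W. \<forall>w\<in>W. v + w \<in> W \<and> v - w \<in> W" and v: "v \<in> carrier_vec (N + M)"
    have gen': "x @\<^sub>v A *\<^sub>v x \<in> W" if "A \<in> R" "x \<in> carrier_vec N" for A x
      using gen g[OF that] that by (metis UnI1 image_eqI)
    \<comment> \<open>Evaluation at \<open>e\<close> is injective between sets of equal size
      \<open>q ^ M\<close>, hence onto.\<close>
    have "inj_on (\<lambda>A. A *\<^sub>v e) R"
      using diff e by (intro inj_onI) blast
    then have "card ((\<lambda>A. A *\<^sub>v e) ` R) = card (carrier_vec M :: 'a vec set)"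
      by (simp add: card_image R(2) card_carrier_vec)
    then have "(\<lambda>A. A *\<^sub>v e) ` R = carrier_vec M"
      using Rx[OF _ e(1)] by (intro card_subset_eq finite_carrier_vec) auto
    then have onto: "\<exists>A\<in>R. A *\<^sub>v e = y" if "y \<in> carrier_vec M" for y
      using that by (metis (no_types, lifting) imageE)
    have app_minus: "(x @\<^sub>v y) - (x @\<^sub>v z) = 0\<^sub>v N @\<^sub>v (y - z)"
      if "x \<in> carrier_vec N" "y \<in> carrier_vec M" "z \<in> carrier_vec M" for x y z :: "'a vec"
      using that by (intro eq_vecI) auto
    \<comment> \<open>Subtracting two graph vectors over the same \<open>e\<close> isolates the
      second component.\<close>
    have second: "0\<^sub>v N @\<^sub>v y \<in> W" if y: "y \<in> carrier_vec M" for y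
    proof -
      obtain A B where A: "A \<in> R" "A *\<^sub>v e = y" and B: "B \<in> R" "B *\<^sub>v e = 0\<^sub>v M"
        using onto[OF y] onto[OF zero_carrier_vec] by metis
      have "(e @\<^sub>v y) - (e @\<^sub>v 0\<^sub>v M) \<in> W"
        using gen'[OF A(1) e(1)] gen'[OF B(1) e(1)] A(2) B(2) closed by metis
      moreover have "y - 0\<^sub>v M = y" using y by auto
      ultimately show ?thesis
        using app_minus[OF e(1) y zero_carrier_vec] by simp
    qed
    define z y where "z = vec_first v N" and "y = vec_last v M"
    have zy: "v = z @\<^sub>v y" "z \<in> carrier_vec N" "y \<in> carrier_vec M"
      using v by (auto simp: z_def y_def vec_first_last_append)
    obtain A where A: "A \<in> R"
      using onto[OF zy(3)] by blast
    \<comment> \<open>A graph vector over \<open>z\<close> supplies the first component, and the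
      second is then corrected.\<close>
    have "(z @\<^sub>v A *\<^sub>v z) + (0\<^sub>v N @\<^sub>v (y - A *\<^sub>v z)) \<in> W"
      using gen'[OF A zy(2)] second[of "y - A *\<^sub>v z"] zy(3) Rx[OF A zy(2)] closed by auto
    moreover have "(a @\<^sub>v b) + (0\<^sub>v N @\<^sub>v (c - b)) = a @\<^sub>v c"
      if "a \<in> carrier_vec N" "b \<in> carrier_vec M" "c \<in> carrier_vec M" for a b c :: "'a vec"
      using that by (intro eq_vecI) auto
    note this[OF zy(2) Rx[OF A zy(2)] zy(3)]
    ultimately show "v \<in> W"
      using zy(1) by simp
  qed
  ultimately show ?thesis
    using card by (rule that)
qed

text \<open>Here \<open>Q\<close>, \<open>P\<close> and \<open>T\<close> stand for the powers of q
  with exponents \<open>N\<close>, \<open>N + s\<close> and \<open>k * N + s\<close>. The hypothesis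
  says \<open>c = (T - P) / (Q - 1) + 1\<close>, written without subtracting \<open>P\<close>; each
  extension adds \<open>T\<close> members and multiplies \<open>T\<close> by
  \<open>Q\<close>.\<close>

lemma spread_count_step:
  fixes Q :: nat
  assumes "c * (Q - 1) + P + 1 = T + Q" "Q > 0" "c' = T + c"
  shows "c' * (Q - 1) + P + 1 = Q * T + Q"
proof -
  obtain a where "Q = Suc a"
    using assms(2) gr0_implies_Suc by blast
  then show ?thesis
    using assms by (simp add: algebra_simps)
qed

text \<open>Starting from a single member in dimension \<open>N + s\<close>, each of the
  \<open>k - 1\<close> extensions raises the dimension by \<open>N\<close>.\<close>

lemma ex_partial_spread:
  assumes N: "0 < N" and k: "1 \<le> k"
  shows "\<exists>S :: 'a::{field, finite} mat set. partial_spread (k * N + s) N S \<and>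
    card S * (CARD('a) ^ N - 1) + CARD('a) ^ (N + s) + 1 = CARD('a) ^ (k * N + s) + CARD('a) ^ N"
  using k
proof (induction k rule: dec_induct)
  case base
  let ?u = "1\<^sub>m N @\<^sub>r 0\<^sub>m s N :: 'a mat"
  have "x = 0\<^sub>v N" if x: "x \<in> carrier_vec N" and eq: "?u *\<^sub>v x = 0\<^sub>v (N + s)" for x
  proof -
    have "?u *\<^sub>v x = x @\<^sub>v (0\<^sub>m s N *\<^sub>v x)"
      using mat_mult_append[of "1\<^sub>m N" N N "0\<^sub>m s N" s x] x by simp
    moreover have "0\<^sub>v (N + s) = 0\<^sub>v N @\<^sub>v (0\<^sub>v s :: 'a vec)"
      by (rule eq_vecI) auto
    ultimately have "x @\<^sub>v (0\<^sub>m s N *\<^sub>v x) = 0\<^sub>v N @\<^sub>v 0\<^sub>v s"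
      using eq by metis
    then show ?thesis
      using append_vec_eq[OF x zero_carrier_vec] by blast
  qed
  then have "partial_spread (1 * N + s) N {?u}"
    by (auto simp: partial_spread_def intro!: carrier_append_rows)
  then show ?case
    by (intro exI[of _ "{?u}"]) auto
next
  case (step k)
  then obtain S :: "'a mat set" where S: "partial_spread (k * N + s) N S"
    and card: "card S * (CARD('a) ^ N - 1) + CARD('a) ^ (N + s) + 1
      = CARD('a) ^ (k * N + s) + CARD('a) ^ N"
    by blast
  have "N \<le> k * N + s" using step.hyps by (simp add: trans_le_add1)
  from N this S obtain S' :: "'a mat set" where S': "partial_spread (N + (k * N + s)) N S'"
    "card S' = CARD('a) ^ (k * N + s) + card S"
    by (rule partial_spread_extend)
  have "card S' * (CARD('a) ^ N - 1) + CARD('a) ^ (N + s) + 1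
      = CARD('a) ^ N * CARD('a) ^ (k * N + s) + CARD('a) ^ N"
    by (rule spread_count_step[OF card _ S'(2)]) simp
  then show ?case
    using S'(1) by (intro exI[of _ S']) (simp add: power_add mult_ac add_ac)
qed

section \<open>The length of a Hamming code and the weight bound\<close>

text \<open>The members, placed side by side, form a parity check matrix \<open>H\<close>. A kernel
  word supported on two blocks would give a common vector of two members, so the distance is at
  least 3. Spanning makes \<open>H\<close> onto, and counting fibres yields redundancy
  \<open>r\<close>.\<close>

lemma ex_code_of_partial_spread:
  fixes S :: "'a::{field, finite} mat set"
  assumes N: "0 < N" and S: "partial_spread r N S" "spans_space r N S" and two: "2 \<le> card S"
  shows "\<exists>C :: 'a vec set. linear_code (card S * N) C \<and> 3 \<le> d_SR (card S) N C \<and>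
    redundancy (card S * N) C = r"
proof -
  let ?l = "card S" and ?n = "card S * N"
  have finS: "finite S" and S_carrier: "S \<subseteq> carrier_mat r N"
    and S_disj: "\<And>u u' x x'. \<lbrakk>u \<in> S; u' \<in> S; x \<in> carrier_vec N; x' \<in> carrier_vec N;
      u \<noteq> u'; u *\<^sub>v x = u' *\<^sub>v x'\<rbrakk> \<Longrightarrow> x = 0\<^sub>v N"
    using S(1) unfolding partial_spread_def by blast+
  obtain us where us: "set us = S" "distinct us"
    using finite_distinct_list[OF finS] by blast
  then have len: "length us = ?l"
    using distinct_card by metis
  define H where "H = mat r ?n (\<lambda>(k, t). (us ! (t div N)) $$ (k, t mod N))"
  have H: "H \<in> carrier_mat r ?n" by (simp add: H_def)
  have H_emb: "H *\<^sub>v block_emb ?l N i x = (us ! i) *\<^sub>v x" if i: "i < ?l" and x: "x \<in> carrier_vec N" for i x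
  proof (rule eq_vecI)
    have ui: "us ! i \<in> carrier_mat r N"
      using i us len S_carrier by (metis nth_mem subsetD)
    show "dim_vec (H *\<^sub>v block_emb ?l N i x) = dim_vec ((us ! i) *\<^sub>v x)"
      using ui H by simp
    fix k assume "k < dim_vec ((us ! i) *\<^sub>v x)"
    then have k: "k < r" using ui by simp
    define J where "J = (\<lambda>j. i * N + j) ` {0..<N}"
    have "(H *\<^sub>v block_emb ?l N i x) $ k
        = (\<Sum>t\<in>{0..<?n}. H $$ (k, t) * block_emb ?l N i x $ t)"
      using H k by (simp add: scalar_prod_def block_emb_def)
    also have "\<dots> = (\<Sum>t\<in>J. H $$ (k, t) * block_emb ?l N i x $ t)"
    proof (rule sum.mono_neutral_right)
      show "J \<subseteq> {0..<?n}"
        unfolding J_def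
      proof (rule image_subsetI)
        fix j assume "j \<in> {0..<N}"
        then show "i * N + j \<in> {0..<?n}"
          using block_index_less[OF i, of j N] by simp
      qed
      show "\<forall>t\<in>{0..<?n} - J. H $$ (k, t) * block_emb ?l N i x $ t = 0"
      proof
        fix t assume t: "t \<in> {0..<?n} - J"
        have "t div N \<noteq> i"
        proof
          assume "t div N = i"
          then have "t = i * N + t mod N" by (metis div_mult_mod_eq)
          then show False using t N unfolding J_def by (metis DiffD2 atLeast0LessThan image_eqI lessThan_iff mod_less_divisor)
        qed
        then show "H $$ (k, t) * block_emb ?l N i x $ t = 0"
          using t by (simp add: block_emb_def)
      qed
    qed simp
    also have "\<dots> = (\<Sum>j\<in>{0..<N}. H $$ (k, i * N + j) * block_emb ?l N i x $ (i * N + j))"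
      unfolding J_def by (subst sum.reindex) (simp_all add: inj_on_def)
    also have "\<dots> = (\<Sum>j\<in>{0..<N}. (us ! i) $$ (k, j) * x $ j)"
    proof (rule sum.cong[OF refl])
      fix j assume "j \<in> {0..<N}"
      then have j: "j < N" by simp
      show "H $$ (k, i * N + j) * block_emb ?l N i x $ (i * N + j) = (us ! i) $$ (k, j) * x $ j"
        using block_index_less[OF i j] k j i by (simp add: H_def block_emb_index)
    qed
    also have "\<dots> = ((us ! i) *\<^sub>v x) $ k"
      using ui x k by (simp add: scalar_prod_def)
    finally show "(H *\<^sub>v block_emb ?l N i x) $ k = ((us ! i) *\<^sub>v x) $ k" .
  qed
  define C where "C = {v \<in> carrier_vec ?n. H *\<^sub>v v = 0\<^sub>v r}"
  have code: "linear_code ?n C"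
  proof (rule linear_codeI)
    show "0\<^sub>v ?n \<in> C"
      using H by (auto simp: C_def)
    show "x + y \<in> C" if "x \<in> C" "y \<in> C" for x y
      using that mult_add_distrib_mat_vec[OF H, of x y] by (auto simp: C_def)
    show "a \<cdot>\<^sub>v x \<in> C" if "x \<in> C" for a x
      using that mult_mat_vec[OF H, of x a] by (auto simp: C_def)
  qed (auto simp: C_def)
  have minus_eq: "H *\<^sub>v v = H *\<^sub>v w \<longleftrightarrow> H *\<^sub>v (v - w) = 0\<^sub>v r"
    if "v \<in> carrier_vec ?n" "w \<in> carrier_vec ?n" for v w
  proof -
    have "H *\<^sub>v (v - w) = H *\<^sub>v v - H *\<^sub>v w"
      using mult_minus_distrib_mat_vec[OF H that] .
    moreover have "a = b \<longleftrightarrow> a - b = 0\<^sub>v r" if "a \<in> carrier_vec r" "b \<in> carrier_vec r" for a b :: "'a vec"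
      using that by (auto simp: vec_eq_iff)
    ultimately show ?thesis
      using that H by (metis mult_mat_vec_carrier)
  qed
  have "(\<lambda>v. H *\<^sub>v v) ` carrier_vec ?n = carrier_vec r"
  proof
    show "(\<lambda>v. H *\<^sub>v v) ` carrier_vec ?n \<subseteq> carrier_vec r"
      using H by auto
    let ?W = "(\<lambda>v. H *\<^sub>v v) ` carrier_vec ?n"
    have "\<forall>u\<in>S. \<forall>x\<in>carrier_vec N. u *\<^sub>v x \<in> ?W"
    proof (intro ballI)
      fix u and x :: "'a vec" assume "u \<in> S" and x: "x \<in> carrier_vec N"
      then obtain i where "i < ?l" "u = us ! i"
        using us len by (metis in_set_conv_nth)
      then show "u *\<^sub>v x \<in> ?W"
        using H_emb[of i x] x by (intro image_eqI[of _ _ "block_emb ?l N i x"]) auto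
    qed
    moreover have "\<forall>v\<in>?W. \<forall>w\<in>?W. v + w \<in> ?W \<and> v - w \<in> ?W"
    proof (intro ballI)
      fix a b assume "a \<in> ?W" "b \<in> ?W"
      then obtain v w where v: "v \<in> carrier_vec ?n" "a = H *\<^sub>v v"
        and w: "w \<in> carrier_vec ?n" "b = H *\<^sub>v w" by blast
      have "a + b = H *\<^sub>v (v + w)" "a - b = H *\<^sub>v (v - w)"
        using v w mult_add_distrib_mat_vec[OF H] mult_minus_distrib_mat_vec[OF H] by auto
      then show "a + b \<in> ?W \<and> a - b \<in> ?W"
        using v(1) w(1) by auto
    qed
    ultimately show "carrier_vec r \<subseteq> ?W"
      using S(2) unfolding spans_space_def by blast
  qed
  moreover have "card (carrier_vec ?n :: 'a vec set)
      = card ((\<lambda>v. H *\<^sub>v v) ` carrier_vec ?n) * card {v \<in> carrier_vec ?n. H *\<^sub>v v = 0\<^sub>v r}"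
    by (rule card_fibres) (use minus_eq in \<open>auto simp: finite_carrier_vec\<close>)
  ultimately have "card C * CARD('a) ^ r = CARD('a) ^ ?n"
    by (simp add: C_def card_carrier_vec mult.commute)
  then have "redundancy ?n C = r"
    by (rule redundancy_eqI[OF code])
  moreover have "3 \<le> card (supp_blocks ?l N v)" if "v \<in> C - {0\<^sub>v ?n}" for v
  proof (rule ccontr)
    assume "\<not> 3 \<le> card (supp_blocks ?l N v)"
    then have "card (supp_blocks ?l N v) \<le> 2" by simp
    moreover have "supp_blocks ?l N v \<subseteq> {..<?l}"
      by (auto simp: supp_blocks_def)
    \<comment> \<open>Enlarging the support to exactly two blocks treats the weights 0, 1 and 2 at
      once; this is where \<open>2 \<le> card S\<close> enters.\<close>
    ultimately obtain B where B: "supp_blocks ?l N v \<subseteq> B" "B \<subseteq> {..<?l}" "card B = 2"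
      using two exists_subset_between[of "supp_blocks ?l N v" 2 "{..<?l}"] by auto
    then obtain i j where ij: "B = {i, j}" "i \<noteq> j" "i < ?l" "j < ?l"
      by (auto simp: card_2_iff)
    have v: "v \<in> carrier_vec ?n" "H *\<^sub>v v = 0\<^sub>v r"
      using that by (auto simp: C_def)
    \<comment> \<open>The sign in \<open>y\<close> makes \<open>v\<close> a difference of two
      embeddings, so that \<open>H *\<^sub>v v\<close> being zero becomes an equality between
      vectors of two members.\<close>
    define x y where "x = vec N (\<lambda>k. v $ (i * N + k))" and "y = vec N (\<lambda>k. - v $ (j * N + k))"
    have xy: "x \<in> carrier_vec N" "y \<in> carrier_vec N" by (auto simp: x_def y_def)
    have "v = block_emb ?l N i x - block_emb ?l N j y"
    proof (rule eq_vecI)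
      fix t assume "t < dim_vec (block_emb ?l N i x - block_emb ?l N j y)"
      then have t: "t < ?n" by (simp add: block_emb_def)
      define k m where "k = t div N" and "m = t mod N"
      have km: "k < ?l" "m < N" "t = k * N + m"
        using t N by (auto simp: k_def m_def less_mult_imp_div_less)
      have "(block_emb ?l N i x - block_emb ?l N j y) $ t
          = (if k = i then x $ m else 0) - (if k = j then y $ m else 0)"
        using t km block_emb_index[OF km(1,2), of i x] block_emb_index[OF km(1,2), of j y]
        by (simp add: block_emb_def)
      also have "\<dots> = v $ t"
      proof (cases "k \<in> B")
        case True
        then show ?thesis using km ij(1,2) by (auto simp: x_def y_def)
      next
        case False
        then have "v $ t = 0"
          using B(1) km by (auto simp: supp_blocks_def)
        then show ?thesis using False ij(1) by simp
      qed
      finally show "v $ t = (block_emb ?l N i x - block_emb ?l N j y) $ t" ..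
    qed (use v in \<open>simp add: block_emb_def\<close>)
    then have "H *\<^sub>v block_emb ?l N i x = H *\<^sub>v block_emb ?l N j y"
      using v(2) minus_eq[of "block_emb ?l N i x" "block_emb ?l N j y"] by simp
    then have eq: "(us ! i) *\<^sub>v x = (us ! j) *\<^sub>v y"
      using H_emb ij xy by simp
    have "us ! i \<in> S" "us ! j \<in> S" "us ! i \<noteq> us ! j"
      using ij us len by (auto simp: nth_eq_iff_index_eq)
    then have "x = 0\<^sub>v N" "y = 0\<^sub>v N"
      using S_disj[of "us ! i" "us ! j" x y] S_disj[of "us ! j" "us ! i" y x] eq xy by auto
    then have zero: "v $ (i * N + k) = 0" "v $ (j * N + k) = 0" if "k < N" for k
      using that by (auto simp: x_def y_def vec_eq_iff)
    have "supp_blocks ?l N v = {}"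
      using B(1) ij(1) zero by (auto simp: supp_blocks_def)
    then show False
      using vec_eq_zero_if_supp_blocks_empty[OF v(1)] that by simp
  qed
  then have "3 \<le> d_SR ?l N C"
    using le_d_SR_iff[of 3 ?l N C] by (simp add: numeral_eq_enat)
  ultimately show ?thesis
    using code by blast
qed

text \<open>The code built from a large spanning spread has the same redundancy, so maximality
  forbids it more than \<open>l\<close> blocks. The inequality says that \<open>l\<close> is at
  least the size of that spread.\<close>

lemma proper_SR_Hamming_code_length_bound:
  fixes D :: "'a::{field, finite} vec set"
  assumes D: "proper_SR_Hamming_code l N D" and red: "redundancy (l * N) D = r"
    and l: "0 < l" and N: "0 < N" and r: "N \<le> r"
  shows "CARD('a) ^ r + CARD('a) ^ N
    \<le> l * (CARD('a) ^ N - 1) + CARD('a) ^ (N + r mod N) + 1"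
proof -
  let ?q = "CARD('a)" and ?s = "r mod N"
  define k where "k = r div N"
  have rk: "r = k * N + ?s" by (simp add: k_def)
  have k: "1 \<le> k"
    using r N by (simp add: k_def div_greater_zero_iff Suc_le_eq)
  show ?thesis
  \<comment> \<open>For \<open>k = 1\<close> the claimed spread has a single member, and
    \<open>l > 0\<close> is enough.\<close>
  proof (cases "k = 1")
    case True
    then have "r = N + ?s" using rk by simp
    then have "?q ^ r = ?q ^ (N + ?s)" by simp
    moreover have "1 * (?q ^ N - 1) \<le> l * (?q ^ N - 1)"
      using l by (intro mult_le_mono1) simp
    ultimately show ?thesis by linarith
  next
    case False
    \<comment> \<open>The spread is built one stage short, so that the last extension also provides
      the spanning property.\<close>
    obtain k' where kk': "k = Suc k'"
      using k by (cases k) auto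
    then have k': "1 \<le> k'"
      using False by simp
    have rk': "r = N + (k' * N + ?s)"
      using rk unfolding kk' mult_Suc by (simp only: add.assoc)
    obtain T :: "'a mat set" where T: "partial_spread (k' * N + ?s) N T"
      and cardT: "card T * (?q ^ N - 1) + ?q ^ (N + ?s) + 1 = ?q ^ (k' * N + ?s) + ?q ^ N"
      using ex_partial_spread[OF N k', of ?s] by blast
    have "N \<le> k' * N + ?s" using k' by (simp add: trans_le_add1)
    from N this T obtain S' :: "'a mat set" where
      spread: "partial_spread (N + (k' * N + ?s)) N S'" "spans_space (N + (k' * N + ?s)) N S'"
      and card': "card S' = ?q ^ (k' * N + ?s) + card T"
      by (rule partial_spread_extend)
    have "card S' * (?q ^ N - 1) + ?q ^ (N + ?s) + 1 = ?q ^ N * ?q ^ (k' * N + ?s) + ?q ^ N"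
      by (rule spread_count_step[OF cardT _ card']) simp
    also have "?q ^ N * ?q ^ (k' * N + ?s) = ?q ^ r"
      using rk' by (metis power_add)
    finally have card: "card S' * (?q ^ N - 1) + ?q ^ (N + ?s) + 1 = ?q ^ r + ?q ^ N" .
    have "card S' \<ge> 2"
    proof -
      have "2 \<le> ?q" by (rule two_le_card_field)
      also have "?q \<le> ?q ^ (k' * N + ?s)"
        using N k' by (intro self_le_power) auto
      finally show ?thesis using card' by simp
    qed
    moreover have "partial_spread r N S'" "spans_space r N S'"
      by (subst rk', fact spread)+
    ultimately obtain C' :: "'a vec set" where C': "linear_code (card S' * N) C'"
      "3 \<le> d_SR (card S') N C'" "redundancy (card S' * N) C' = r"
      using ex_code_of_partial_spread[OF N, of r S'] by auto
    have "\<not> (linear_code (l' * N) C' \<and> 3 \<le> d_SR l' N C' \<and>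
        redundancy (l' * N) C' = redundancy (l * N) D)" if "l < l'" for l'
      using D that unfolding proper_SR_Hamming_code_def by blast
    then have "card S' \<le> l"
      using C' red by (metis not_le)
    then have "card S' * (?q ^ N - 1) \<le> l * (?q ^ N - 1)"
      by (intro mult_le_mono1) simp
    then show ?thesis using card by linarith
  qed
qed

text \<open>Eliminating \<open>l\<close> from the two inequalities gives \<open>key\<close>. For
  remainder 0 the powers of q in it cancel, leaving \<open>w\<close> at least the quotient.\<close>

lemma weight_lower_bound_arith:
  fixes q l w N r :: nat
  assumes q: "2 \<le> q" and N: "0 < N" "N \<le> r" and w: "w \<le> l"
    and l: "q ^ r + q ^ N \<le> l * (q ^ N - 1) + q ^ (N + r mod N) + 1"
    and zero: "1 + (l - w) * (q ^ N - 1) \<le> q ^ (r - 1)"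
  shows "(if r mod N = 0 then \<lceil>real q ^ (r - 1) * (real q - 1) / (real q ^ N - 1)\<rceil>
    else \<lfloor>real q ^ (r - 1) * (real q - 1) / (real q ^ N - 1)\<rfloor> - int q ^ (r mod N) + 1) \<le> int w"
proof -
  let ?s = "r mod N" and ?a = "real q ^ N - 1"
  define \<rho> where "\<rho> = real q ^ (r - 1) * (real q - 1) / ?a"
  have a: "?a > 0" using q N by simp
  have qN: "real (q ^ N - 1) = ?a"
    using q by (simp add: of_nat_diff)
  have "real (q ^ r + q ^ N) \<le> real (l * (q ^ N - 1) + q ^ (N + ?s) + 1)"
    using l by (simp only: of_nat_le_iff)
  then have 1: "real q ^ r + real q ^ N \<le> real l * ?a + real q ^ (N + ?s) + 1"
    by (simp only: of_nat_add of_nat_mult of_nat_power qN of_nat_1)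
  have "real (1 + (l - w) * (q ^ N - 1)) \<le> real (q ^ (r - 1))"
    using zero by (simp only: of_nat_le_iff)
  then have 2: "1 + (real l - real w) * ?a \<le> real q ^ (r - 1)"
    using w by (simp only: of_nat_add of_nat_mult of_nat_power qN of_nat_1 of_nat_diff)
  have "real q ^ r = real q ^ (r - 1) * real q"
    using N power_minus_mult[of r "real q"] by simp
  then have rho_a: "\<rho> * ?a = real q ^ r - real q ^ (r - 1)"
  proof -
    have "\<rho> * ?a = real q ^ (r - 1) * (real q - 1)"
      using a by (simp add: \<rho>_def)
    then show ?thesis
      using \<open>real q ^ r = real q ^ (r - 1) * real q\<close> by (simp add: right_diff_distrib)
  qed
  have key: "\<rho> * ?a + real q ^ N - real q ^ (N + ?s) \<le> real w * ?a"
    using 1 2 unfolding rho_a by (simp add: algebra_simps)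
  show ?thesis
  proof (cases "?s = 0")
    case True
    then have "\<rho> * ?a \<le> real w * ?a" using key by simp
    then have "\<rho> \<le> real w" using a by simp
    then show ?thesis using True by (simp add: \<rho>_def ceiling_le_iff)
  next
    case False
    have "\<lfloor>\<rho>\<rfloor> - int q ^ ?s + 1 \<le> int w"
    \<comment> \<open>By integrality a failure means \<open>w + q ^ s\<close> is at most the floor.
      Multiplying by \<open>q ^ N - 1\<close> and comparing with \<open>key\<close> leaves
      \<open>q ^ N \<le> q ^ s\<close>, against \<open>s < N\<close>.\<close>
    proof (rule ccontr)
      assume "\<not> ?thesis"
      then have "int w + int q ^ ?s \<le> \<lfloor>\<rho>\<rfloor>" by simp
      then have "real w + real q ^ ?s \<le> \<rho>"
        by (simp add: le_floor_iff)
      then have "(real w + real q ^ ?s) * ?a \<le> \<rho> * ?a"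
        using a by (intro mult_right_mono) auto
      then have "real q ^ N \<le> real q ^ ?s"
        using key by (simp add: algebra_simps power_add)
      moreover have "real q ^ ?s < real q ^ N"
        using q N by (intro power_strict_increasing) auto
      ultimately show False by simp
    qed
    then show ?thesis using False by (simp add: \<rho>_def)
  qed
qed

theorem theorem7:
  fixes C :: "'a::{field, finite} vec set" and q l N n r s :: nat
  assumes q: "q = CARD('a)"
    and l: "l > 0" and N: "N > 0" and n: "n = l * N"
    and r: "r \<ge> N" and s: "s = r mod N"
    and simplex: "proper_SR_simplex_code l N C"
    and dim: "code_dim n C = r"
  shows "ereal_of_enat (d_SR l N C) \<ge> ereal (of_int
           (if s = 0
            then \<lceil>real q ^ (r - 1) * (real q - 1) / (real q ^ N - 1)\<rceil>
            else \<lfloor>real q ^ (r - 1) * (real q - 1) / (real q ^ N - 1)\<rfloor> - int q ^ s + 1))"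
    (is "_ \<ge> ereal (of_int ?b)")
proof -
  let ?D = "dual_code (l * N) C"
  have C: "linear_code (l * N) C" and D: "proper_SR_Hamming_code l N ?D"
    using simplex by (auto simp: proper_SR_simplex_code_def)
  have cardC: "card C = q ^ r"
    using card_linear_code[OF C] dim n q by simp
  have "redundancy (l * N) ?D = r"
    by (rule redundancy_eqI[OF linear_code_dual_code[OF linear_code_subset[OF C]]])
      (use card_mult_card_dual_code[OF C] cardC q in \<open>simp add: mult.commute\<close>)
  note length = proper_SR_Hamming_code_length_bound[OF D this l N r, folded q]
  have bound: "?b \<le> int (card (supp_blocks l N c))" if c: "c \<in> C - {0\<^sub>v (l * N)}" for c
    unfolding s
  proof (rule weight_lower_bound_arith[OF _ N r _ length])
    show "2 \<le> q"
      using two_le_card_field[where 'a = 'a] q by simp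
    show "card (supp_blocks l N c) \<le> l"
      using card_mono[of "{..<l}" "supp_blocks l N c"] by (auto simp: supp_blocks_def)
    show "1 + (l - card (supp_blocks l N c)) * (q ^ N - 1) \<le> q ^ (r - 1)"
      unfolding q
      by (rule card_zero_blocks_bound[OF C])
        (use c cardC q r N D in \<open>auto simp: proper_SR_Hamming_code_def\<close>)
  qed
  \<comment> \<open>The bound may be negative when \<open>s > 0\<close>; \<open>nat\<close> then
    raises it to 0, which weights still satisfy.\<close>
  have "enat (nat ?b) \<le> d_SR l N C"
    unfolding le_d_SR_iff using bound by (simp add: nat_le_iff)
  then have "ereal_of_enat (enat (nat ?b)) \<le> ereal_of_enat (d_SR l N C)"
    by (simp only: ereal_of_enat_le_iff)
  moreover have "ereal (of_int ?b) \<le> ereal_of_enat (enat (nat ?b))"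
    unfolding ereal_of_enat_simps ereal_less_eq by linarith
  ultimately show ?thesis
    by (rule order_trans[rotated])
qed

end
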